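(* Let $\mathcal{B}$ be the free braided (strict) monoidal category on one object. Realise $\mathcal{B}$ as a doubly degenerate tricategory: it has one $0$-cell and one $1$-cell, its $2$-cells are the natural numbers, its $3$-cells $n\to m$ are the elements of $\mathcal{B}(n,m)$, composition along both $0$-cells and $1$-cells is given by $\otimes$, and the interchange constraint is derived from the braiding. This is indeed a tricategory (in fact a Gray-category, since everything is strict except interchange), and it does not arise as a Penon $3$-category: it cannot be expressed as a doubly degenerate Penon $3$-category, and does not satisfy the axioms for a Penon $3$-category.
   Context: Explicitly, $\mathcal{B}$ has as objects the natural numbers; $\mathcal{B}(n,n)$ is the $n$th braid group, and $\mathcal{B}(n,m)=\emptyset$ if $m\neq n$. The tensor product is addition on objects and juxtaposition of braids on morphisms; the unit object is $0$; the braiding $m+n\to n+m$ is the braid crossing $m$ strands past $n$ strands. A $3$-dimensional reflexive globular set $A$ consists of sets $A(0),A(1),A(2),A(3)$ (elements of $A(k)$ are $k$-cells), maps $s,t:A(k)\to A(k-1)$ for $1\le k\le 3$, and maps $i:A(k)\to A(k+1)$ for $0\le k\le 2$, with $ss=st$, $ts=tt$, $si=ti=1$. Maps commute with $s,t,i$; the resulting category is $\mathbf{RGSet}_3$. A ($3$-dimensional) magma is a $3$-dimensional reflexive globular set with, for all $1\le m\le 3$, $0\le k\le m-1$ and $\alpha,\beta\in A(m)$ with $t^{m-k}\alpha=s^{m-k}\beta$, a composite $\beta\circ_k\alpha\in A(m)$ such that: if $k<m-1$ then $s(\beta\circ_k\alpha)=s(\beta)\circ_k s(\alpha)$ and $t(\beta\circ_k\alpha)=t(\beta)\circ_k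 t(\alpha)$; if $k=m-1$ then $s(\beta\circ_k\alpha)=s(\alpha)$ and $t(\beta\circ_k\alpha)=t(\beta)$. No further axioms are imposed. Maps of magmas are maps of reflexive globular sets preserving composition. Every strict $3$-category has an underlying magma. Two $k$-cells $\alpha,\beta$ are parallel if $k=0$, or $k\ge1$ and $s\alpha=s\beta$, $t\alpha=t\beta$. A contraction $[\ ,\ ]$ on a map $f:A\to B$ of $3$-dimensional reflexive globular sets gives, for each $k<3$ and each pair of parallel $k$-cells $\alpha,\beta$ of $A$ with $f\alpha=f\beta$, a $(k+1)$-cell $[\alpha,\beta]:\alpha\to\beta$ such that $f[\alpha,\beta]=i(f\alpha)$ and $[\alpha,\alpha]=i\alpha$; and for $k=3$ any parallel $\alpha,\beta$ with $f\alpha=f\beta$ must be equal. The category $\mathcal{Q}$ has as objects quadruples $(A,B,f,[\ ,\ ])$ where $A$ is a magma, $B$ is a strict $3$-category, $f:A\to B$ is a map of magmas, and $[\ ,\ ]$ is a contraction on $f$. A morphism to $(A',B',f',[\ ,\ ])$ is a pair consisting of a map of magmas $g_1:A\to A'$ and a map of strict $3$-categories $g_2:B\to B'$ with $f'g_1=g_2f$ and $g_1[\alpha,\beta]=[g_1\alpha,g_1\beta]$ for every contraction cell. The forgetful functor $U:\mathcal{Q}\to\mathbf{RGSet}_3$, sending $(A,B,f,[\ ,\ ])$ to the underlying reflexive globular set of $A$, has a left adjoint; $P_3$ is the induced monad on $\mathbf{RGSet}_3$. A Penon $3$-category is a $P_3$-algebra $\theta:P_3A\to A$; it is doubly degenerate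 if $A$ has only one $0$-cell and only one $1$-cell. A doubly degenerate Penon $3$-category gives rise to a monoidal category whose objects are the $2$-cells, whose morphisms are the $3$-cells, and whose tensor product is vertical composition of $2$-cells (composition along the $1$-cell). *)

theory Defs
  imports Main
begin

section \<open>Reflexive globular sets and magmas\<close>

text \<open>Everything is 3-dimensional: only the values of the fields in dimensions at most 3 matter.
  The first argument of \<open>src\<close>, \<open>tgt\<close> and \<open>idt\<close> is the dimension of the cell they are applied to.\<close>

record 'a rgset =
  cells :: "nat \<Rightarrow> 'a set"
  src :: "nat \<Rightarrow> 'a \<Rightarrow> 'a"
  tgt :: "nat \<Rightarrow> 'a \<Rightarrow> 'a"
  idt :: "nat \<Rightarrow> 'a \<Rightarrow> 'a"

definition rgset :: "('a, 'x) rgset_scheme \<Rightarrow> bool" where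
  "rgset A \<longleftrightarrow>
     (\<forall>k x. 1 \<le> k \<and> k \<le> 3 \<and> x \<in> cells A k \<longrightarrow>
        src A k x \<in> cells A (k - 1) \<and> tgt A k x \<in> cells A (k - 1)) \<and>
     (\<forall>k x. k \<le> 2 \<and> x \<in> cells A k \<longrightarrow>
        idt A k x \<in> cells A (k + 1) \<and>
        src A (k + 1) (idt A k x) = x \<and> tgt A (k + 1) (idt A k x) = x) \<and>
     (\<forall>k x. 2 \<le> k \<and> k \<le> 3 \<and> x \<in> cells A k \<longrightarrow>
        src A (k - 1) (src A k x) = src A (k - 1) (tgt A k x) \<and>
        tgt A (k - 1) (src A k x) = tgt A (k - 1) (tgt A k x))"

definition rg_map ::
  "('a, 'x) rgset_scheme \<Rightarrow> ('b, 'y) rgset_scheme \<Rightarrow> (nat \<Rightarrow> 'a \<Rightarrow> 'b) \<Rightarrow> bool" where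
  "rg_map A B g \<longleftrightarrow>
     (\<forall>k x. k \<le> 3 \<and> x \<in> cells A k \<longrightarrow> g k x \<in> cells B k) \<and>
     (\<forall>k x. 1 \<le> k \<and> k \<le> 3 \<and> x \<in> cells A k \<longrightarrow>
        g (k - 1) (src A k x) = src B k (g k x) \<and> g (k - 1) (tgt A k x) = tgt B k (g k x)) \<and>
     (\<forall>k x. k \<le> 2 \<and> x \<in> cells A k \<longrightarrow> g (k + 1) (idt A k x) = idt B k (g k x))"

text \<open>\<open>bsrc A k d\<close>, \<open>btgt A k d\<close>: the \<open>k\<close>-dimensional source and target of a \<open>(k + d)\<close>-cell;
  \<open>bidt A k d\<close>: the \<open>(k + d)\<close>-dimensional iterated identity on a \<open>k\<close>-cell.\<close>

primrec bsrc :: "('a, 'x) rgset_scheme \<Rightarrow> nat \<Rightarrow> nat \<Rightarrow> 'a \<Rightarrow> 'a" where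
  "bsrc A k 0 x = x"
| "bsrc A k (Suc d) x = bsrc A k d (src A (k + Suc d) x)"

primrec btgt :: "('a, 'x) rgset_scheme \<Rightarrow> nat \<Rightarrow> nat \<Rightarrow> 'a \<Rightarrow> 'a" where
  "btgt A k 0 x = x"
| "btgt A k (Suc d) x = btgt A k d (tgt A (k + Suc d) x)"

primrec bidt :: "('a, 'x) rgset_scheme \<Rightarrow> nat \<Rightarrow> nat \<Rightarrow> 'a \<Rightarrow> 'a" where
  "bidt A k 0 x = x"
| "bidt A k (Suc d) x = idt A (k + d) (bidt A k d x)"

text \<open>\<open>comp A m k \<beta> \<alpha>\<close> is the composite \<open>\<beta> \<circ>\<^sub>k \<alpha>\<close> of two \<open>m\<close>-cells, \<open>\<alpha>\<close> first.\<close>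

record 'a magma = "'a rgset" +
  comp :: "nat \<Rightarrow> nat \<Rightarrow> 'a \<Rightarrow> 'a \<Rightarrow> 'a"

definition composable ::
  "('a, 'x) rgset_scheme \<Rightarrow> nat \<Rightarrow> nat \<Rightarrow> 'a \<Rightarrow> 'a \<Rightarrow> bool" where
  "composable A m k \<beta> \<alpha> \<longleftrightarrow> k < m \<and> m \<le> 3 \<and> \<beta> \<in> cells A m \<and> \<alpha> \<in> cells A m \<and>
     btgt A k (m - k) \<alpha> = bsrc A k (m - k) \<beta>"

definition magma :: "('a, 'x) magma_scheme \<Rightarrow> bool" where
  "magma A \<longleftrightarrow> rgset A \<and>
     (\<forall>m k \<beta> \<alpha>. composable A m k \<beta> \<alpha> \<longrightarrow>
        comp A m k \<beta> \<alpha> \<in> cells A m \<and>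
        (if k = m - 1
         then src A m (comp A m k \<beta> \<alpha>) = src A m \<alpha> \<and> tgt A m (comp A m k \<beta> \<alpha>) = tgt A m \<beta>
         else src A m (comp A m k \<beta> \<alpha>) = comp A (m - 1) k (src A m \<beta>) (src A m \<alpha>) \<and>
              tgt A m (comp A m k \<beta> \<alpha>) = comp A (m - 1) k (tgt A m \<beta>) (tgt A m \<alpha>)))"

definition magma_map ::
  "('a, 'x) magma_scheme \<Rightarrow> ('b, 'y) magma_scheme \<Rightarrow> (nat \<Rightarrow> 'a \<Rightarrow> 'b) \<Rightarrow> bool" where
  "magma_map A B g \<longleftrightarrow> rg_map A B g \<and>
     (\<forall>m k \<beta> \<alpha>. composable A m k \<beta> \<alpha> \<longrightarrow>
        g m (comp A m k \<beta> \<alpha>) = comp B m k (g m \<beta>) (g m \<alpha>))"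

definition magma_iso ::
  "('a, 'x) magma_scheme \<Rightarrow> ('b, 'y) magma_scheme \<Rightarrow> (nat \<Rightarrow> 'a \<Rightarrow> 'b) \<Rightarrow> bool" where
  "magma_iso A B g \<longleftrightarrow> magma_map A B g \<and> (\<forall>k\<le>3. bij_betw (g k) (cells A k) (cells B k))"

section \<open>Strict 3-categories, contractions and Penon's category Q\<close>

text \<open>A strict 3-category is identified with its underlying magma, and a map of strict
  3-categories is a map of the underlying magmas.\<close>

definition strict_3_category :: "('a, 'x) magma_scheme \<Rightarrow> bool" where
  "strict_3_category C \<longleftrightarrow> magma C \<and>
     (\<forall>m k \<gamma> \<beta> \<alpha>. composable C m k \<gamma> \<beta> \<and> composable C m k \<beta> \<alpha> \<longrightarrow>
        comp C m k (comp C m k \<gamma> \<beta>) \<alpha> = comp C m k \<gamma> (comp C m k \<beta> \<alpha>)) \<and>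
     (\<forall>m k \<alpha>. k < m \<and> m \<le> 3 \<and> \<alpha> \<in> cells C m \<longrightarrow>
        comp C m k \<alpha> (bidt C k (m - k) (bsrc C k (m - k) \<alpha>)) = \<alpha> \<and>
        comp C m k (bidt C k (m - k) (btgt C k (m - k) \<alpha>)) \<alpha> = \<alpha>) \<and>
     (\<forall>m k \<beta> \<alpha>. m \<le> 2 \<and> composable C m k \<beta> \<alpha> \<longrightarrow>
        comp C (m + 1) k (idt C m \<beta>) (idt C m \<alpha>) = idt C m (comp C m k \<beta> \<alpha>)) \<and>
     (\<forall>m l k \<delta> \<gamma> \<beta> \<alpha>. k < l \<and>
        composable C m l \<delta> \<gamma> \<and> composable C m l \<beta> \<alpha> \<and> composable C m k \<gamma> \<alpha> \<longrightarrow>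
        comp C m k (comp C m l \<delta> \<gamma>) (comp C m l \<beta> \<alpha>) =
        comp C m l (comp C m k \<delta> \<beta>) (comp C m k \<gamma> \<alpha>))"

definition parallel :: "('a, 'x) rgset_scheme \<Rightarrow> nat \<Rightarrow> 'a \<Rightarrow> 'a \<Rightarrow> bool" where
  "parallel A k \<alpha> \<beta> \<longleftrightarrow> \<alpha> \<in> cells A k \<and> \<beta> \<in> cells A k \<and>
     (k = 0 \<or> src A k \<alpha> = src A k \<beta> \<and> tgt A k \<alpha> = tgt A k \<beta>)"

definition contraction ::
  "('a, 'x) rgset_scheme \<Rightarrow> ('b, 'y) rgset_scheme \<Rightarrow> (nat \<Rightarrow> 'a \<Rightarrow> 'b) \<Rightarrow>
   (nat \<Rightarrow> 'a \<Rightarrow> 'a \<Rightarrow> 'a) \<Rightarrow> bool" where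
  "contraction A B f c \<longleftrightarrow>
     (\<forall>k \<alpha> \<beta>. k < 3 \<and> parallel A k \<alpha> \<beta> \<and> f k \<alpha> = f k \<beta> \<longrightarrow>
        c k \<alpha> \<beta> \<in> cells A (k + 1) \<and>
        src A (k + 1) (c k \<alpha> \<beta>) = \<alpha> \<and> tgt A (k + 1) (c k \<alpha> \<beta>) = \<beta> \<and>
        f (k + 1) (c k \<alpha> \<beta>) = idt B k (f k \<alpha>)) \<and>
     (\<forall>k \<alpha>. k < 3 \<and> \<alpha> \<in> cells A k \<longrightarrow> c k \<alpha> \<alpha> = idt A k \<alpha>) \<and>
     (\<forall>\<alpha> \<beta>. parallel A 3 \<alpha> \<beta> \<and> f 3 \<alpha> = f 3 \<beta> \<longrightarrow> \<alpha> = \<beta>)"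

record 'u qobj =
  qmag :: "'u magma"
  qcat :: "'u magma"
  qmap :: "nat \<Rightarrow> 'u \<Rightarrow> 'u"
  qctr :: "nat \<Rightarrow> 'u \<Rightarrow> 'u \<Rightarrow> 'u"

definition q_object :: "'u qobj \<Rightarrow> bool" where
  "q_object Q \<longleftrightarrow> magma (qmag Q) \<and> strict_3_category (qcat Q) \<and>
     magma_map (qmag Q) (qcat Q) (qmap Q) \<and> contraction (qmag Q) (qcat Q) (qmap Q) (qctr Q)"

definition q_morphism ::
  "'u qobj \<Rightarrow> 'u qobj \<Rightarrow> (nat \<Rightarrow> 'u \<Rightarrow> 'u) \<Rightarrow> (nat \<Rightarrow> 'u \<Rightarrow> 'u) \<Rightarrow> bool" where
  "q_morphism Q Q' g1 g2 \<longleftrightarrow>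
     magma_map (qmag Q) (qmag Q') g1 \<and> magma_map (qcat Q) (qcat Q') g2 \<and>
     (\<forall>k x. k \<le> 3 \<and> x \<in> cells (qmag Q) k \<longrightarrow> qmap Q' k (g1 k x) = g2 k (qmap Q k x)) \<and>
     (\<forall>k \<alpha> \<beta>. k < 3 \<and> parallel (qmag Q) k \<alpha> \<beta> \<and> qmap Q k \<alpha> = qmap Q k \<beta> \<longrightarrow>
        g1 (k + 1) (qctr Q k \<alpha> \<beta>) = qctr Q' k (g1 k \<alpha>) (g1 k \<beta>))"

definition q_forget :: "'u qobj \<Rightarrow> 'u rgset" where
  "q_forget Q = rgset.truncate (qmag Q)"

section \<open>The left adjoint, the induced monad and its algebras\<close>

text \<open>Smallness is relative to the type \<open>'u\<close>: reflexive globular sets and objects of Q have their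
  cells in \<open>'u\<close>.  For infinite \<open>'u\<close> the free object on a reflexive globular set in \<open>'u\<close> has no more
  cells than \<open>'u\<close> has elements, so it has a copy in \<open>'u\<close>, and a left adjoint in the sense below is
  the absolute one up to isomorphism.  Maps are compared on cells of dimension at most 3 only.\<close>

definition q_extension ::
  "('u rgset \<Rightarrow> 'u qobj) \<Rightarrow> ('u rgset \<Rightarrow> nat \<Rightarrow> 'u \<Rightarrow> 'u) \<Rightarrow>
   'u rgset \<Rightarrow> 'u qobj \<Rightarrow> (nat \<Rightarrow> 'u \<Rightarrow> 'u) \<Rightarrow>
   (nat \<Rightarrow> 'u \<Rightarrow> 'u) \<Rightarrow> (nat \<Rightarrow> 'u \<Rightarrow> 'u) \<Rightarrow> bool" where
  "q_extension F \<eta> X Q h g1 g2 \<longleftrightarrow> q_morphism (F X) Q g1 g2 \<and>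
     (\<forall>k x. k \<le> 3 \<and> x \<in> cells X k \<longrightarrow> g1 k (\<eta> X k x) = h k x)"

text \<open>\<open>(F X, \<eta> X)\<close> is a universal arrow from \<open>X\<close> to the forgetful functor, for every \<open>X\<close>.\<close>

definition left_adjoint_of_forget ::
  "('u rgset \<Rightarrow> 'u qobj) \<Rightarrow> ('u rgset \<Rightarrow> nat \<Rightarrow> 'u \<Rightarrow> 'u) \<Rightarrow> bool" where
  "left_adjoint_of_forget F \<eta> \<longleftrightarrow>
     (\<forall>X. rgset X \<longrightarrow>
        q_object (F X) \<and> rg_map X (q_forget (F X)) (\<eta> X) \<and>
        (\<forall>Q h. q_object Q \<and> rg_map X (q_forget Q) h \<longrightarrow>
           (\<exists>g1 g2. q_extension F \<eta> X Q h g1 g2) \<and>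
           (\<forall>g1 g2 g1' g2'. q_extension F \<eta> X Q h g1 g2 \<and> q_extension F \<eta> X Q h g1' g2' \<longrightarrow>
              (\<forall>k\<le>3. (\<forall>x\<in>cells (qmag (F X)) k. g1 k x = g1' k x) \<and>
                      (\<forall>y\<in>cells (qcat (F X)) k. g2 k y = g2' k y)))))"

definition P_obj :: "('u rgset \<Rightarrow> 'u qobj) \<Rightarrow> 'u rgset \<Rightarrow> 'u rgset" where
  "P_obj F X = q_forget (F X)"

text \<open>The magma component of the extension of \<open>h\<close> along \<open>\<eta> X\<close>; it is determined on cells.\<close>

definition q_lift ::
  "('u rgset \<Rightarrow> 'u qobj) \<Rightarrow> ('u rgset \<Rightarrow> nat \<Rightarrow> 'u \<Rightarrow> 'u) \<Rightarrow>
   'u rgset \<Rightarrow> 'u qobj \<Rightarrow> (nat \<Rightarrow> 'u \<Rightarrow> 'u) \<Rightarrow> nat \<Rightarrow> 'u \<Rightarrow> 'u" where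
  "q_lift F \<eta> X Q h = (SOME g1. \<exists>g2. q_extension F \<eta> X Q h g1 g2)"

definition P_map ::
  "('u rgset \<Rightarrow> 'u qobj) \<Rightarrow> ('u rgset \<Rightarrow> nat \<Rightarrow> 'u \<Rightarrow> 'u) \<Rightarrow>
   'u rgset \<Rightarrow> 'u rgset \<Rightarrow> (nat \<Rightarrow> 'u \<Rightarrow> 'u) \<Rightarrow> nat \<Rightarrow> 'u \<Rightarrow> 'u" where
  "P_map F \<eta> X Y h = q_lift F \<eta> X (F Y) (\<lambda>k x. \<eta> Y k (h k x))"

definition P_mult ::
  "('u rgset \<Rightarrow> 'u qobj) \<Rightarrow> ('u rgset \<Rightarrow> nat \<Rightarrow> 'u \<Rightarrow> 'u) \<Rightarrow>
   'u rgset \<Rightarrow> nat \<Rightarrow> 'u \<Rightarrow> 'u" where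
  "P_mult F \<eta> X = q_lift F \<eta> (P_obj F X) (F X) (\<lambda>k x. x)"

definition penon_3_category ::
  "('u rgset \<Rightarrow> 'u qobj) \<Rightarrow> ('u rgset \<Rightarrow> nat \<Rightarrow> 'u \<Rightarrow> 'u) \<Rightarrow>
   'u rgset \<Rightarrow> (nat \<Rightarrow> 'u \<Rightarrow> 'u) \<Rightarrow> bool" where
  "penon_3_category F \<eta> A \<theta> \<longleftrightarrow> rgset A \<and> rg_map (P_obj F A) A \<theta> \<and>
     (\<forall>k x. k \<le> 3 \<and> x \<in> cells A k \<longrightarrow> \<theta> k (\<eta> A k x) = x) \<and>
     (\<forall>k z. k \<le> 3 \<and> z \<in> cells (P_obj F (P_obj F A)) k \<longrightarrow>
        \<theta> k (P_mult F \<eta> A k z) = \<theta> k (P_map F \<eta> (P_obj F A) A \<theta> k z))"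

definition doubly_degenerate :: "('a, 'x) rgset_scheme \<Rightarrow> bool" where
  "doubly_degenerate A \<longleftrightarrow> (\<exists>!x. x \<in> cells A 0) \<and> (\<exists>!x. x \<in> cells A 1)"

text \<open>The composition operations of a Penon 3-category: compose formally in the free object and
  evaluate.\<close>

definition penon_composition ::
  "('u rgset \<Rightarrow> 'u qobj) \<Rightarrow> ('u rgset \<Rightarrow> nat \<Rightarrow> 'u \<Rightarrow> 'u) \<Rightarrow>
   'u rgset \<Rightarrow> (nat \<Rightarrow> 'u \<Rightarrow> 'u) \<Rightarrow> 'u magma" where
  "penon_composition F \<eta> A \<theta> = rgset.extend A (magma.fields
     (\<lambda>m k \<beta> \<alpha>. \<theta> m (comp (qmag (F A)) m k (\<eta> A m \<beta>) (\<eta> A m \<alpha>))))"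

section \<open>Monoidal categories read off from doubly degenerate structures\<close>

text \<open>Only the objects, morphisms, composition, unit and tensor product are recorded, not the
  associativity and unit constraints.\<close>

record ('o, 'm) mon_cat =
  Ob :: "'o set"
  Mor :: "'m set"
  mdom :: "'m \<Rightarrow> 'o"
  mcod :: "'m \<Rightarrow> 'o"
  mid :: "'o \<Rightarrow> 'm"
  mcomp :: "'m \<Rightarrow> 'm \<Rightarrow> 'm"
  munit :: "'o"
  mtens_ob :: "'o \<Rightarrow> 'o \<Rightarrow> 'o"
  mtens :: "'m \<Rightarrow> 'm \<Rightarrow> 'm"

definition monoidal_of :: "('a, 'x) magma_scheme \<Rightarrow> ('a, 'a) mon_cat" where
  "monoidal_of A = \<lparr>
     Ob = cells A 2, Mor = cells A 3, mdom = src A 3, mcod = tgt A 3, mid = idt A 2,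
     mcomp = comp A 3 2, munit = idt A 1 (THE x. x \<in> cells A 1),
     mtens_ob = comp A 2 1, mtens = comp A 3 1\<rparr>"

definition mon_cat_iso ::
  "('o, 'm) mon_cat \<Rightarrow> ('p, 'n) mon_cat \<Rightarrow> ('o \<Rightarrow> 'p) \<Rightarrow> ('m \<Rightarrow> 'n) \<Rightarrow> bool" where
  "mon_cat_iso V W u v \<longleftrightarrow>
     bij_betw u (Ob V) (Ob W) \<and> bij_betw v (Mor V) (Mor W) \<and>
     (\<forall>f\<in>Mor V. mdom W (v f) = u (mdom V f) \<and> mcod W (v f) = u (mcod V f)) \<and>
     (\<forall>x\<in>Ob V. v (mid V x) = mid W (u x)) \<and>
     (\<forall>g\<in>Mor V. \<forall>f\<in>Mor V. mcod V f = mdom V g \<longrightarrow>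
        v (mcomp V g f) = mcomp W (v g) (v f)) \<and>
     u (munit V) = munit W \<and>
     (\<forall>x\<in>Ob V. \<forall>y\<in>Ob V. u (mtens_ob V x y) = mtens_ob W (u x) (u y)) \<and>
     (\<forall>f\<in>Mor V. \<forall>g\<in>Mor V. v (mtens V f g) = mtens W (v f) (v g))"

section \<open>Gray-categories\<close>

text \<open>A Gray-category is presented by homogeneous composites: whiskering by a 1-cell is composition
  along a 0-cell with its iterated identity, and the composite of 2-cells (and 3-cells)
  \<open>\<gamma> : f \<Rightarrow> f'\<close>, \<open>\<delta> : g \<Rightarrow> g'\<close> along a 0-cell is
  \<open>(\<delta> whiskered with f') \<circ>\<^sub>1 (\<gamma> whiskered with g)\<close>.  The interchanger \<open>ichg \<delta> \<gamma>\<close> is an invertible 3-cell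
  from this composite to \<open>(\<gamma> whiskered with g') \<circ>\<^sub>1 (\<delta> whiskered with f)\<close>.\<close>

record 'a gray = "'a magma" +
  ichg :: "'a \<Rightarrow> 'a \<Rightarrow> 'a"

definition whl :: "('a, 'x) magma_scheme \<Rightarrow> nat \<Rightarrow> 'a \<Rightarrow> 'a \<Rightarrow> 'a" where
  "whl G m g x = comp G m 0 (bidt G 1 (m - 1) g) x"

definition whr :: "('a, 'x) magma_scheme \<Rightarrow> nat \<Rightarrow> 'a \<Rightarrow> 'a \<Rightarrow> 'a" where
  "whr G m x f = comp G m 0 x (bidt G 1 (m - 1) f)"

text \<open>For \<open>k \<ge> 1\<close>: the cells with given 0-source and 0-target form a strict 2-category.\<close>

definition hom_2_categories :: "('a, 'x) magma_scheme \<Rightarrow> bool" where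
  "hom_2_categories G \<longleftrightarrow>
     (\<forall>m k \<gamma> \<beta> \<alpha>. 1 \<le> k \<and> composable G m k \<gamma> \<beta> \<and> composable G m k \<beta> \<alpha> \<longrightarrow>
        comp G m k (comp G m k \<gamma> \<beta>) \<alpha> = comp G m k \<gamma> (comp G m k \<beta> \<alpha>)) \<and>
     (\<forall>m k \<alpha>. 1 \<le> k \<and> k < m \<and> m \<le> 3 \<and> \<alpha> \<in> cells G m \<longrightarrow>
        comp G m k \<alpha> (bidt G k (m - k) (bsrc G k (m - k) \<alpha>)) = \<alpha> \<and>
        comp G m k (bidt G k (m - k) (btgt G k (m - k) \<alpha>)) \<alpha> = \<alpha>) \<and>
     (\<forall>\<beta> \<alpha>. composable G 2 1 \<beta> \<alpha> \<longrightarrow>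
        comp G 3 1 (idt G 2 \<beta>) (idt G 2 \<alpha>) = idt G 2 (comp G 2 1 \<beta> \<alpha>)) \<and>
     (\<forall>\<delta> \<gamma> \<beta> \<alpha>. composable G 3 2 \<delta> \<gamma> \<and> composable G 3 2 \<beta> \<alpha> \<and> composable G 3 1 \<gamma> \<alpha> \<longrightarrow>
        comp G 3 1 (comp G 3 2 \<delta> \<gamma>) (comp G 3 2 \<beta> \<alpha>) =
        comp G 3 2 (comp G 3 1 \<delta> \<beta>) (comp G 3 1 \<gamma> \<alpha>))"

text \<open>Whiskering with a 1-cell is a strict 2-functor on either side, and is associative and unital.\<close>

definition whiskering_laws :: "('a, 'x) magma_scheme \<Rightarrow> bool" where
  "whiskering_laws G \<longleftrightarrow>
     (\<forall>g m k \<beta> \<alpha>. 1 \<le> k \<and> composable G m k \<beta> \<alpha> \<and> g \<in> cells G 1 \<longrightarrow>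
        (src G 1 g = btgt G 0 m \<alpha> \<longrightarrow>
           whl G m g (comp G m k \<beta> \<alpha>) = comp G m k (whl G m g \<beta>) (whl G m g \<alpha>)) \<and>
        (tgt G 1 g = bsrc G 0 m \<alpha> \<longrightarrow>
           whr G m (comp G m k \<beta> \<alpha>) g = comp G m k (whr G m \<beta> g) (whr G m \<alpha> g))) \<and>
     (\<forall>g m x. 1 \<le> m \<and> m \<le> 2 \<and> x \<in> cells G m \<and> g \<in> cells G 1 \<longrightarrow>
        (src G 1 g = btgt G 0 m x \<longrightarrow> whl G (m + 1) g (idt G m x) = idt G m (whl G m g x)) \<and>
        (tgt G 1 g = bsrc G 0 m x \<longrightarrow> whr G (m + 1) (idt G m x) g = idt G m (whr G m x g))) \<and>
     (\<forall>m x. 1 \<le> m \<and> m \<le> 3 \<and> x \<in> cells G m \<longrightarrow>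
        whl G m (idt G 0 (btgt G 0 m x)) x = x \<and> whr G m x (idt G 0 (bsrc G 0 m x)) = x) \<and>
     (\<forall>h g m x. 1 \<le> m \<and> m \<le> 3 \<and> x \<in> cells G m \<and> h \<in> cells G 1 \<and> g \<in> cells G 1 \<longrightarrow>
        (src G 1 h = tgt G 1 g \<and> src G 1 g = btgt G 0 m x \<longrightarrow>
           whl G m h (whl G m g x) = whl G m (comp G 1 0 h g) x) \<and>
        (src G 1 h = btgt G 0 m x \<and> tgt G 1 g = bsrc G 0 m x \<longrightarrow>
           whr G m (whl G m h x) g = whl G m h (whr G m x g)) \<and>
        (tgt G 1 h = bsrc G 0 m x \<and> tgt G 1 g = src G 1 h \<longrightarrow>
           whr G m (whr G m x h) g = whr G m x (comp G 1 0 h g)))"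

definition horizontal_convention :: "('a, 'x) magma_scheme \<Rightarrow> bool" where
  "horizontal_convention G \<longleftrightarrow>
     (\<forall>m y x. 2 \<le> m \<and> composable G m 0 y x \<longrightarrow>
        comp G m 0 y x =
        comp G m 1 (whr G m y (btgt G 1 (m - 1) x)) (whl G m (bsrc G 1 (m - 1) y) x))"

definition interchanger_laws :: "('a, 'x) gray_scheme \<Rightarrow> bool" where
  "interchanger_laws G \<longleftrightarrow>
     (\<forall>\<delta> \<gamma>. composable G 2 0 \<delta> \<gamma> \<longrightarrow>
        ichg G \<delta> \<gamma> \<in> cells G 3 \<and>
        src G 3 (ichg G \<delta> \<gamma>) =
          comp G 2 1 (whr G 2 \<delta> (tgt G 2 \<gamma>)) (whl G 2 (src G 2 \<delta>) \<gamma>) \<and>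
        tgt G 3 (ichg G \<delta> \<gamma>) =
          comp G 2 1 (whl G 2 (tgt G 2 \<delta>) \<gamma>) (whr G 2 \<delta> (src G 2 \<gamma>)) \<and>
        (\<exists>\<iota>\<in>cells G 3. src G 3 \<iota> = tgt G 3 (ichg G \<delta> \<gamma>) \<and> tgt G 3 \<iota> = src G 3 (ichg G \<delta> \<gamma>) \<and>
           comp G 3 2 \<iota> (ichg G \<delta> \<gamma>) = idt G 2 (src G 3 (ichg G \<delta> \<gamma>)) \<and>
           comp G 3 2 (ichg G \<delta> \<gamma>) \<iota> = idt G 2 (tgt G 3 (ichg G \<delta> \<gamma>)))) \<and>
     (\<forall>\<psi> \<phi>. composable G 3 0 \<psi> \<phi> \<longrightarrow>
        comp G 3 2 (ichg G (tgt G 3 \<psi>) (tgt G 3 \<phi>))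
          (comp G 3 1 (whr G 3 \<psi> (btgt G 1 2 \<phi>)) (whl G 3 (bsrc G 1 2 \<psi>) \<phi>)) =
        comp G 3 2
          (comp G 3 1 (whl G 3 (btgt G 1 2 \<psi>) \<phi>) (whr G 3 \<psi> (bsrc G 1 2 \<phi>)))
          (ichg G (src G 3 \<psi>) (src G 3 \<phi>))) \<and>
     (\<forall>g \<gamma>. g \<in> cells G 1 \<and> \<gamma> \<in> cells G 2 \<and> src G 1 g = btgt G 0 2 \<gamma> \<longrightarrow>
        ichg G (idt G 1 g) \<gamma> = idt G 2 (whl G 2 g \<gamma>)) \<and>
     (\<forall>\<delta> f. \<delta> \<in> cells G 2 \<and> f \<in> cells G 1 \<and> bsrc G 0 2 \<delta> = tgt G 1 f \<longrightarrow>
        ichg G \<delta> (idt G 1 f) = idt G 2 (whr G 2 \<delta> f)) \<and>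
     (\<forall>\<delta> \<gamma>' \<gamma>. composable G 2 0 \<delta> \<gamma> \<and> composable G 2 1 \<gamma>' \<gamma> \<longrightarrow>
        ichg G \<delta> (comp G 2 1 \<gamma>' \<gamma>) =
        comp G 3 2
          (comp G 3 1 (idt G 2 (whl G 2 (tgt G 2 \<delta>) \<gamma>')) (ichg G \<delta> \<gamma>))
          (comp G 3 1 (ichg G \<delta> \<gamma>') (idt G 2 (whl G 2 (src G 2 \<delta>) \<gamma>)))) \<and>
     (\<forall>\<delta>' \<delta> \<gamma>. composable G 2 0 \<delta> \<gamma> \<and> composable G 2 1 \<delta>' \<delta> \<longrightarrow>
        ichg G (comp G 2 1 \<delta>' \<delta>) \<gamma> =
        comp G 3 2
          (comp G 3 1 (ichg G \<delta>' \<gamma>) (idt G 2 (whr G 2 \<delta> (src G 2 \<gamma>))))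
          (comp G 3 1 (idt G 2 (whr G 2 \<delta>' (tgt G 2 \<gamma>))) (ichg G \<delta> \<gamma>))) \<and>
     (\<forall>h \<delta> \<gamma>. h \<in> cells G 1 \<and> composable G 2 0 \<delta> \<gamma> \<and> src G 1 h = btgt G 0 2 \<delta> \<longrightarrow>
        ichg G (whl G 2 h \<delta>) \<gamma> = whl G 3 h (ichg G \<delta> \<gamma>)) \<and>
     (\<forall>\<delta> g \<gamma>. g \<in> cells G 1 \<and> \<delta> \<in> cells G 2 \<and> \<gamma> \<in> cells G 2 \<and>
        bsrc G 0 2 \<delta> = tgt G 1 g \<and> src G 1 g = btgt G 0 2 \<gamma> \<longrightarrow>
        ichg G (whr G 2 \<delta> g) \<gamma> = ichg G \<delta> (whl G 2 g \<gamma>)) \<and>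
     (\<forall>\<delta> \<gamma> f. f \<in> cells G 1 \<and> composable G 2 0 \<delta> \<gamma> \<and> bsrc G 0 2 \<gamma> = tgt G 1 f \<longrightarrow>
        ichg G \<delta> (whr G 2 \<gamma> f) = whr G 3 (ichg G \<delta> \<gamma>) f)"

definition gray_category :: "('a, 'x) gray_scheme \<Rightarrow> bool" where
  "gray_category G \<longleftrightarrow> magma G \<and> hom_2_categories G \<and> whiskering_laws G \<and>
     horizontal_convention G \<and> interchanger_laws G"

section \<open>Braids\<close>

text \<open>Artin's presentation: the letter \<open>(i, True)\<close> is the generator crossing the strands in positions
  \<open>i\<close> and \<open>i + 1\<close> (counted from 0), \<open>(i, False)\<close> its inverse.  Words are read in temporal order.\<close>

type_synonym braid_word = "(nat \<times> bool) list"

definition braid_words :: "nat \<Rightarrow> braid_word set" where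
  "braid_words n = {w. \<forall>(i, e)\<in>set w. Suc i < n}"

inductive braid_eq :: "nat \<Rightarrow> braid_word \<Rightarrow> braid_word \<Rightarrow> bool" for n :: nat where
  refl: "w \<in> braid_words n \<Longrightarrow> braid_eq n w w"
| sym: "braid_eq n w w' \<Longrightarrow> braid_eq n w' w"
| trans: "braid_eq n w w' \<Longrightarrow> braid_eq n w' w'' \<Longrightarrow> braid_eq n w w''"
| cancel: "\<lbrakk>u \<in> braid_words n; v \<in> braid_words n; Suc i < n\<rbrakk> \<Longrightarrow>
    braid_eq n (u @ [(i, e), (i, \<not> e)] @ v) (u @ v)"
| far: "\<lbrakk>u \<in> braid_words n; v \<in> braid_words n; Suc i < j; Suc j < n\<rbrakk> \<Longrightarrow>
    braid_eq n (u @ [(i, True), (j, True)] @ v) (u @ [(j, True), (i, True)] @ v)"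
| braid: "\<lbrakk>u \<in> braid_words n; v \<in> braid_words n; Suc (Suc i) < n\<rbrakk> \<Longrightarrow>
    braid_eq n (u @ [(i, True), (Suc i, True), (i, True)] @ v)
               (u @ [(Suc i, True), (i, True), (Suc i, True)] @ v)"

definition braid_rel :: "nat \<times> braid_word \<Rightarrow> nat \<times> braid_word \<Rightarrow> bool" where
  "braid_rel p q \<longleftrightarrow> fst p = fst q \<and> braid_eq (fst p) (snd p) (snd q)"

lemma braid_eq_words: "braid_eq n w w' \<Longrightarrow> w \<in> braid_words n \<and> w' \<in> braid_words n"
  by (induction rule: braid_eq.induct) (auto simp: braid_words_def)

lemma append_words: "u @ v \<in> braid_words n \<longleftrightarrow> u \<in> braid_words n \<and> v \<in> braid_words n"
  by (auto simp: braid_words_def)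

lemma braid_eq_append_right:
  "braid_eq n w w' \<Longrightarrow> x \<in> braid_words n \<Longrightarrow> braid_eq n (w @ x) (w' @ x)"
proof (induction rule: braid_eq.induct)
  case (refl w)
  then show ?case by (simp add: append_words braid_eq.refl)
next
  case (sym w w')
  then show ?case by (blast intro: braid_eq.sym)
next
  case (trans w w' w'')
  then show ?case by (blast intro: braid_eq.trans)
next
  case (cancel u v i e)
  then show ?case using braid_eq.cancel[of u n "v @ x" i e] by (simp add: append_words)
next
  case (far u v i j)
  then show ?case using braid_eq.far[of u n "v @ x" i j] by (simp add: append_words)
next
  case (braid u v i)
  then show ?case using braid_eq.braid[of u n "v @ x" i] by (simp add: append_words)
qed

lemma braid_eq_append_left:
  "braid_eq n w w' \<Longrightarrow> x \<in> braid_words n \<Longrightarrow> braid_eq n (x @ w) (x @ w')"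
proof (induction rule: braid_eq.induct)
  case (refl w)
  then show ?case by (simp add: append_words braid_eq.refl)
next
  case (sym w w')
  then show ?case by (blast intro: braid_eq.sym)
next
  case (trans w w' w'')
  then show ?case by (blast intro: braid_eq.trans)
next
  case (cancel u v i e)
  then show ?case using braid_eq.cancel[of "x @ u" n v i e] by (simp add: append_words)
next
  case (far u v i j)
  then show ?case using braid_eq.far[of "x @ u" n v i j] by (simp add: append_words)
next
  case (braid u v i)
  then show ?case using braid_eq.braid[of "x @ u" n v i] by (simp add: append_words)
qed

lemma braid_eq_append:
  assumes "braid_eq n u u'" "braid_eq n w w'"
  shows "braid_eq n (u @ w) (u' @ w')"
  using assms braid_eq_words braid_eq_append_left braid_eq_append_right braid_eq.trans by meson

definition shift :: "nat \<Rightarrow> braid_word \<Rightarrow> braid_word" where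
  "shift m w = map (\<lambda>(i, e). (m + i, e)) w"

lemma shift_words: "w \<in> braid_words n \<Longrightarrow> shift m w \<in> braid_words (m + n)"
  by (fastforce simp: braid_words_def shift_def)

lemma widen_words: "w \<in> braid_words m \<Longrightarrow> w \<in> braid_words (m + n)"
  by (fastforce simp: braid_words_def)

lemma braid_eq_shift: "braid_eq n w w' \<Longrightarrow> braid_eq (m + n) (shift m w) (shift m w')"
proof (induction rule: braid_eq.induct)
  case (refl w)
  then show ?case by (intro braid_eq.refl shift_words)
next
  case (sym w w')
  then show ?case by (blast intro: braid_eq.sym)
next
  case (trans w w' w'')
  then show ?case by (blast intro: braid_eq.trans)
next
  case (cancel u v i e)
  then show ?case
    using braid_eq.cancel[of "shift m u" "m + n" "shift m v" "m + i" e] shift_words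
    by (auto simp: shift_def)
next
  case (far u v i j)
  then show ?case
    using braid_eq.far[of "shift m u" "m + n" "shift m v" "m + i" "m + j"] shift_words
    by (auto simp: shift_def)
next
  case (braid u v i)
  then show ?case
    using braid_eq.braid[of "shift m u" "m + n" "shift m v" "m + i"] shift_words
    by (auto simp: shift_def)
qed

lemma braid_eq_widen: "braid_eq m w w' \<Longrightarrow> braid_eq (m + n) w w'"
proof (induction rule: braid_eq.induct)
  case (refl w)
  then show ?case by (intro braid_eq.refl widen_words)
next
  case (sym w w')
  then show ?case by (blast intro: braid_eq.sym)
next
  case (trans w w' w'')
  then show ?case by (blast intro: braid_eq.trans)
next
  case (cancel u v i e)
  then show ?case by (intro braid_eq.cancel widen_words) auto
next
  case (far u v i j)
  then show ?case by (intro braid_eq.far widen_words) auto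
next
  case (braid u v i)
  then show ?case by (intro braid_eq.braid widen_words) auto
qed

text \<open>An element of \<open>braid\<close> is a number of strands together with an element of the corresponding
  braid group.\<close>

quotient_type braid = "nat \<times> braid_word" / partial: braid_rel
proof (rule part_equivpI)
  show "\<exists>x. braid_rel x x"
    by (intro exI[of _ "(0, [])"]) (auto simp: braid_rel_def braid_words_def intro: braid_eq.refl)
  show "symp braid_rel"
    by (auto simp: symp_def braid_rel_def intro: braid_eq.sym)
  show "transp braid_rel"
    by (auto simp: transp_def braid_rel_def intro: braid_eq.trans)
qed

lift_definition strands :: "braid \<Rightarrow> nat" is fst
  by (simp add: braid_rel_def)

lift_definition braid_id :: "nat \<Rightarrow> braid" is "\<lambda>n. (n, [])"
  by (auto simp: braid_rel_def braid_words_def intro: braid_eq.refl)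

text \<open>\<open>braid_comp c b\<close> is \<open>b\<close> followed by \<open>c\<close>; it is meaningful only for equal numbers of strands.\<close>

lift_definition braid_comp :: "braid \<Rightarrow> braid \<Rightarrow> braid" is
  "\<lambda>(n, w) (m, v). if m = n then (n, v @ w) else (n, w)"
  by (auto simp: braid_rel_def intro: braid_eq_append)

lift_definition braid_tensor :: "braid \<Rightarrow> braid \<Rightarrow> braid" is
  "\<lambda>(m, w) (n, v). (m + n, w @ shift m v)"
  by (clarsimp simp: braid_rel_def) (intro braid_eq_append braid_eq_shift braid_eq_widen)

text \<open>Cross \<open>m\<close> strands past \<open>n\<close> strands, starting with the last one of the \<open>m\<close> strands.\<close>

primrec crossing :: "nat \<Rightarrow> nat \<Rightarrow> nat list" where
  "crossing 0 n = []"
| "crossing (Suc m) n = [m..<m + n] @ crossing m n"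

lemma crossing_bound: "i \<in> set (crossing m n) \<Longrightarrow> Suc i < m + n"
  by (induction m) auto

lift_definition braiding :: "nat \<Rightarrow> nat \<Rightarrow> braid" is
  "\<lambda>m n. (m + n, map (\<lambda>i. (i, True)) (crossing m n))"
  by (auto simp: braid_rel_def braid_words_def dest: crossing_bound intro!: braid_eq.refl)

text \<open>The free braided strict monoidal category on one object; its braiding is \<open>braiding\<close>.\<close>

definition braid_category :: "(nat, braid) mon_cat" where
  "braid_category = \<lparr>
     Ob = UNIV, Mor = UNIV, mdom = strands, mcod = strands, mid = braid_id,
     mcomp = braid_comp, munit = 0, mtens_ob = (+), mtens = braid_tensor\<rparr>"

section \<open>The braid category as a doubly degenerate tricategory\<close>

datatype bcell = Pt | Arr | Two nat | Three braid

fun b_cells :: "nat \<Rightarrow> bcell set" where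
  "b_cells 0 = {Pt}"
| "b_cells (Suc 0) = {Arr}"
| "b_cells (Suc (Suc 0)) = range Two"
| "b_cells (Suc (Suc (Suc 0))) = range Three"
| "b_cells _ = {}"

fun b_bdry :: "bcell \<Rightarrow> bcell" where
  "b_bdry Pt = Pt"
| "b_bdry Arr = Pt"
| "b_bdry (Two n) = Arr"
| "b_bdry (Three b) = Two (strands b)"

fun b_idt :: "bcell \<Rightarrow> bcell" where
  "b_idt Pt = Arr"
| "b_idt Arr = Two 0"
| "b_idt (Two n) = Three (braid_id n)"
| "b_idt (Three b) = Three b"

text \<open>Composition along 0-cells and 1-cells is the tensor product, along 2-cells it is the
  composition of braids. The catch-all clause covers the only 1-cell, which is an identity, and
  arguments that are not cells of the same dimension.\<close>

fun b_comp :: "nat \<Rightarrow> bcell \<Rightarrow> bcell \<Rightarrow> bcell" where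
  "b_comp k (Two m) (Two n) = Two (m + n)"
| "b_comp k (Three b) (Three c) =
     Three (if k = 2 then braid_comp b c else braid_tensor b c)"
| "b_comp k x y = x"

fun b_ichg :: "bcell \<Rightarrow> bcell \<Rightarrow> bcell" where
  "b_ichg (Two m) (Two n) = Three (braiding m n)"
| "b_ichg x y = x"

definition braid_gray :: "bcell gray" where
  "braid_gray = \<lparr>
     cells = b_cells, src = (\<lambda>k. b_bdry), tgt = (\<lambda>k. b_bdry), idt = (\<lambda>k. b_idt),
     comp = (\<lambda>m. b_comp), ichg = b_ichg\<rparr>"

end

theory Submission
  imports Defs
begin

text \<open>In a strict 3-category, composition along a 1-cell is commutative on 3-cells whose 1-dimensional
  source and target are an identity, by the Eckmann-Hilton argument.  Let \<open>f, g\<close> be 3-cells \<open>z \<rightarrow> z\<close> of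
  a doubly degenerate Penon 3-category \<open>A\<close>.  The formal composites of \<open>\<eta> f\<close> and \<open>\<eta> g\<close> in the two
  orders are parallel, since \<open>f\<close> and \<open>g\<close> have the same boundary, and they agree in the strict
  3-category underneath, because maps of reflexive globular sets preserve the identity that is the
  only 1-cell of \<open>A\<close>.  A contraction identifies such 3-cells, so \<open>f \<otimes> g = g \<otimes> f\<close>
  in \<open>A\<close>, without any coherence cells.  In the braid category, the generator \<open>\<sigma>\<close> of the
  braid group on two strands gives \<open>\<sigma> \<otimes> 1 \<noteq> 1 \<otimes> \<sigma>\<close> on four strands: the underlying permutations differ.\<close>

section \<open>Commutativity of the tensor product\<close>

text \<open>Composition along \<open>p\<close> and composition along its identity 1-cell share a
  unit on the 3-cells considered, so interchange forces the two to coincide and to commute. The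
  2-dimensional boundaries of \<open>a\<close> and \<open>b\<close> may be arbitrary.\<close>

lemma strict_3_category_eckmann_hilton:
  assumes C: "strict_3_category C" and p: "p \<in> cells C 0"
    and a: "a \<in> cells C 3" "bsrc C 1 2 a = idt C 0 p" "btgt C 1 2 a = idt C 0 p"
    and b: "b \<in> cells C 3" "bsrc C 1 2 b = idt C 0 p" "btgt C 1 2 b = idt C 0 p"
  shows "comp C 3 1 a b = comp C 3 1 b a"
proof -
  define e where "e = bidt C 0 3 p"
  have rg: "rgset C"
    using C by (auto simp: strict_3_category_def magma_def)
  have units: "comp C m k x (bidt C k (m - k) (bsrc C k (m - k) x)) = x"
      "comp C m k (bidt C k (m - k) (btgt C k (m - k) x)) x = x"
    if "k < m" "m \<le> 3" "x \<in> cells C m" for m k x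
    using C that by (auto simp: strict_3_category_def)
  have interchange: "comp C 3 0 (comp C 3 1 d c) (comp C 3 1 b a) =
      comp C 3 1 (comp C 3 0 d b) (comp C 3 0 c a)"
    if "composable C 3 1 d c" "composable C 3 1 b a" "composable C 3 0 c a" for a b c d
    using C that unfolding strict_3_category_def by (metis zero_less_one)
  have idt: "idt C k x \<in> cells C (Suc k) \<and> src C (Suc k) (idt C k x) = x \<and>
      tgt C (Suc k) (idt C k x) = x" if "k \<le> 2" "x \<in> cells C k" for k x
    using rg that unfolding rgset_def by (metis Suc_eq_plus1)
  have ip: "src C (Suc 0) (idt C 0 p) = p" "tgt C (Suc 0) (idt C 0 p) = p"
    "idt C 0 p \<in> cells C (Suc 0)"
    using idt[of 0 p] p by auto
  have ip2: "src C 2 (idt C (Suc 0) (idt C 0 p)) = idt C 0 p"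
    "tgt C 2 (idt C (Suc 0) (idt C 0 p)) = idt C 0 p"
    "idt C (Suc 0) (idt C 0 p) \<in> cells C 2"
    using idt[of 1 "idt C 0 p"] ip by (auto simp: numeral_2_eq_2)
  have e: "e \<in> cells C 3" "bsrc C 1 2 e = idt C 0 p" "btgt C 1 2 e = idt C 0 p"
    using idt[of 2 "idt C (Suc 0) (idt C 0 p)"] ip2
    by (auto simp: e_def eval_nat_numeral)
  \<comment> \<open>The cell \<open>e\<close> is at once the threefold identity on \<open>p\<close>
    and the twofold identity on \<open>idt C 0 p\<close>, which makes it a unit for both
    compositions.\<close>
  have e1: "e = bidt C (Suc 0) 2 (idt C 0 p)"
    by (simp add: e_def eval_nat_numeral)
  have split: "bsrc C 0 3 x = src C 1 (bsrc C 1 2 x)" "btgt C 0 3 x = tgt C 1 (btgt C 1 2 x)" for x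
    by (simp_all add: eval_nat_numeral)
  define good where "good = (\<lambda>x. x \<in> cells C 3 \<and> bsrc C 1 2 x = idt C 0 p \<and> btgt C 1 2 x = idt C 0 p)"
  have c1: "composable C 3 1 x y" and c0: "composable C 3 0 x y"
    if "good x" "good y" for x y
    using that ip by (auto simp: composable_def good_def split)
  have u: "comp C 3 1 x e = x" "comp C 3 1 e x = x" "comp C 3 0 x e = x" "comp C 3 0 e x = x"
    if "good x" for x
    using units[of 1 3 x] units[of 0 3 x] that ip
    by (auto simp: good_def split e1[symmetric] e_def[symmetric])
  have good: "good a" "good b" "good e"
    using a b e by (auto simp: good_def)
  \<comment> \<open>Units pad the pair to a two by two array with \<open>a\<close> and
    \<open>b\<close> on a diagonal; interchange turns this into \<open>comp C 3 0 a b\<close>, and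
    padding on the other side gives the opposite order.\<close>
  have "comp C 3 1 a b = comp C 3 1 (comp C 3 0 a e) (comp C 3 0 e b)"
    using u good by simp
  also have "\<dots> = comp C 3 0 a b"
    using interchange[of a e e b] u good c1 c0 by simp
  also have "\<dots> = comp C 3 1 (comp C 3 0 e b) (comp C 3 0 a e)"
    using interchange[of e a b e] u good c1 c0 by simp
  also have "\<dots> = comp C 3 1 b a"
    using u good by simp
  finally show ?thesis .
qed

text \<open>A magma in Q may have many 1-cells, so the identity boundary of \<open>z\<close> is a
  hypothesis here; degeneracy supplies it for the cells coming from a Penon 3-category.\<close>

lemma q_object_tensor_commute:
  assumes Q: "q_object Q" and p: "p \<in> cells (qmag Q) 0"
    and z: "src (qmag Q) 2 z = idt (qmag Q) 0 p" "tgt (qmag Q) 2 z = idt (qmag Q) 0 p"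
    and f: "f \<in> cells (qmag Q) 3" "src (qmag Q) 3 f = z" "tgt (qmag Q) 3 f = z"
    and g: "g \<in> cells (qmag Q) 3" "src (qmag Q) 3 g = z" "tgt (qmag Q) 3 g = z"
  shows "comp (qmag Q) 3 1 f g = comp (qmag Q) 3 1 g f"
proof -
  let ?A = "qmag Q" and ?B = "qcat Q" and ?q = "qmap Q"
  have mag: "magma ?A" and strict: "strict_3_category ?B" and map: "magma_map ?A ?B ?q"
    and contr: "contraction ?A ?B ?q (qctr Q)"
    using Q by (auto simp: q_object_def)
  have rg: "rg_map ?A ?B ?q"
    using map by (simp add: magma_map_def)
  have st: "?q (k - 1) (src ?A k x) = src ?B k (?q k x) \<and> ?q (k - 1) (tgt ?A k x) = tgt ?B k (?q k x)"
    if "1 \<le> k" "k \<le> 3" "x \<in> cells ?A k" for k x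
    using rg that by (simp add: rg_map_def)
  have cell: "?q k x \<in> cells ?B k" if "k \<le> 3" "x \<in> cells ?A k" for k x
    using rg that by (simp add: rg_map_def)
  have zc: "z \<in> cells ?A 2"
  proof -
    have "rgset ?A" using mag by (simp add: magma_def)
    then have "src ?A 3 f \<in> cells ?A (3 - 1)"
      using f(1) unfolding rgset_def by (metis one_le_numeral order_refl)
    then show ?thesis by (simp add: f(2))
  qed
  have idp: "?q 1 (idt ?A 0 p) = idt ?B 0 (?q 0 p)"
  proof -
    have "0 \<le> (2::nat) \<and> p \<in> cells ?A 0 \<longrightarrow> ?q (0 + 1) (idt ?A 0 p) = idt ?B 0 (?q 0 p)"
      using rg unfolding rg_map_def by blast
    then show ?thesis using p by simp
  qed
  have img: "?q 3 x \<in> cells ?B 3 \<and> bsrc ?B 1 2 (?q 3 x) = idt ?B 0 (?q 0 p) \<and>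
      btgt ?B 1 2 (?q 3 x) = idt ?B 0 (?q 0 p)"
    if "x \<in> cells ?A 3" "src ?A 3 x = z" "tgt ?A 3 x = z" for x
  proof -
    have "src ?B 3 (?q 3 x) = ?q 2 z" "tgt ?B 3 (?q 3 x) = ?q 2 z"
      using st[of 3 x] that by auto
    moreover have "src ?B 2 (?q 2 z) = idt ?B 0 (?q 0 p)" "tgt ?B 2 (?q 2 z) = idt ?B 0 (?q 0 p)"
      using st[of 2 z] zc z idp by auto
    ultimately show ?thesis
      using cell[of 3 x] that(1) by (simp add: eval_nat_numeral)
  qed
  have comm: "comp ?B 3 1 (?q 3 f) (?q 3 g) = comp ?B 3 1 (?q 3 g) (?q 3 f)"
    using img[of f] img[of g] f g cell[of 0 p] p
    by (intro strict_3_category_eckmann_hilton[OF strict, of "?q 0 p"]) auto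
  have cp: "composable ?A 3 1 x y"
    if "x \<in> cells ?A 3" "src ?A 3 x = z" "tgt ?A 3 x = z"
       "y \<in> cells ?A 3" "src ?A 3 y = z" "tgt ?A 3 y = z" for x y
    using that z by (simp add: composable_def eval_nat_numeral)
  have q: "?q 3 (comp ?A 3 1 x y) = comp ?B 3 1 (?q 3 x) (?q 3 y)" if "composable ?A 3 1 x y" for x y
    using map that by (simp add: magma_map_def)
  have bd: "comp ?A 3 1 x y \<in> cells ?A 3 \<and> src ?A 3 (comp ?A 3 1 x y) = comp ?A 2 1 (src ?A 3 x) (src ?A 3 y)
     \<and> tgt ?A 3 (comp ?A 3 1 x y) = comp ?A 2 1 (tgt ?A 3 x) (tgt ?A 3 y)"
    if "composable ?A 3 1 x y" for x y
  proof -
    have "comp ?A 3 1 x y \<in> cells ?A 3 \<and> (if 1 = (3::nat) - 1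
         then src ?A 3 (comp ?A 3 1 x y) = src ?A 3 y \<and> tgt ?A 3 (comp ?A 3 1 x y) = tgt ?A 3 x
         else src ?A 3 (comp ?A 3 1 x y) = comp ?A (3 - 1) 1 (src ?A 3 x) (src ?A 3 y) \<and>
              tgt ?A 3 (comp ?A 3 1 x y) = comp ?A (3 - 1) 1 (tgt ?A 3 x) (tgt ?A 3 y))"
      using mag that unfolding magma_def by blast
    then show ?thesis by simp
  qed
  \<comment> \<open>Composition along the 1-cell composes the boundaries, and these are all
    \<open>z\<close>: both composites go from \<open>z\<close> composed with itself to the same
    2-cell.\<close>
  have "parallel ?A 3 (comp ?A 3 1 f g) (comp ?A 3 1 g f)"
    using bd[OF cp[OF f g]] bd[OF cp[OF g f]] f g by (simp add: parallel_def)
  moreover have "?q 3 (comp ?A 3 1 f g) = ?q 3 (comp ?A 3 1 g f)"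
    using q cp f g comm by simp
  ultimately show ?thesis
    using contr unfolding contraction_def by blast
qed

text \<open>The two formal composites are already equal in the free object; evaluation by \<theta>
  merely transports the equality to \<open>A\<close>.\<close>

lemma penon_tensor_commute:
  assumes adj: "left_adjoint_of_forget F \<eta>" and A: "rgset A" and dd: "doubly_degenerate A"
    and f: "f \<in> cells A 3" "src A 3 f = z" "tgt A 3 f = z"
    and g: "g \<in> cells A 3" "src A 3 g = z" "tgt A 3 g = z"
  shows "comp (penon_composition F \<eta> A \<theta>) 3 1 f g = comp (penon_composition F \<eta> A \<theta>) 3 1 g f"
proof -
  have Q: "q_object (F A)" and \<eta>: "rg_map A (q_forget (F A)) (\<eta> A)"
    using adj A by (auto simp: left_adjoint_of_forget_def)
  let ?M = "qmag (F A)"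
  have [simp]: "cells (q_forget (F A)) = cells ?M" "src (q_forget (F A)) = src ?M"
    "tgt (q_forget (F A)) = tgt ?M" "idt (q_forget (F A)) = idt ?M"
    by (simp_all add: q_forget_def rgset.truncate_def)
  have st: "\<eta> A (k - 1) (src A k x) = src ?M k (\<eta> A k x) \<and> \<eta> A (k - 1) (tgt A k x) = tgt ?M k (\<eta> A k x)"
    if "1 \<le> k" "k \<le> 3" "x \<in> cells A k" for k x
    using \<eta> that by (simp add: rg_map_def)
  have cell: "\<eta> A k x \<in> cells ?M k" if "k \<le> 3" "x \<in> cells A k" for k x
    using \<eta> that by (simp add: rg_map_def)
  have stA: "src A k x \<in> cells A (k - 1) \<and> tgt A k x \<in> cells A (k - 1)"
    if "1 \<le> k" "k \<le> 3" "x \<in> cells A k" for k x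
    using A that by (simp add: rgset_def)
  obtain p where p: "p \<in> cells A 0"
    using dd by (auto simp: doubly_degenerate_def)
  have ip: "idt A 0 p \<in> cells A 1"
  proof -
    have "0 \<le> (2::nat) \<and> p \<in> cells A 0 \<longrightarrow> idt A 0 p \<in> cells A (0 + 1)"
      using A unfolding rgset_def by blast
    then show ?thesis using p by simp
  qed
  have i\<eta>: "\<eta> A 1 (idt A 0 p) = idt ?M 0 (\<eta> A 0 p)"
  proof -
    have "0 \<le> (2::nat) \<and> p \<in> cells A 0 \<longrightarrow> \<eta> A (0 + 1) (idt A 0 p) = idt (q_forget (F A)) 0 (\<eta> A 0 p)"
      using \<eta> unfolding rg_map_def by blast
    then show ?thesis using p by simp
  qed
  have z: "z \<in> cells A 2"
    using stA[of 3 f] f by simp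
  \<comment> \<open>Degeneracy enters here: the only 1-cell of \<open>A\<close> is the identity on
    \<open>p\<close>, and the unit map \<eta> sends it to an identity.\<close>
  then have "src A 2 z = idt A 0 p" "tgt A 2 z = idt A 0 p"
    using dd ip stA[of 2 z] by (auto simp: doubly_degenerate_def)
  then have "src ?M 2 (\<eta> A 2 z) = idt ?M 0 (\<eta> A 0 p)" "tgt ?M 2 (\<eta> A 2 z) = idt ?M 0 (\<eta> A 0 p)"
    using st[of 2 z] z i\<eta> by auto
  then have "comp ?M 3 1 (\<eta> A 3 f) (\<eta> A 3 g) = comp ?M 3 1 (\<eta> A 3 g) (\<eta> A 3 f)"
    using cell[of 0 p] p cell[of 3 f] cell[of 3 g] st[of 3 f] st[of 3 g] f g
    by (intro q_object_tensor_commute[OF Q, of "\<eta> A 0 p" "\<eta> A 2 z"]) auto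
  then show ?thesis
    by (simp add: penon_composition_def rgset.extend_def magma.fields_def)
qed

section \<open>Calculus of braid words\<close>

text \<open>The quotient is partial, so \<open>Br n w\<close> is under control only for
  \<open>w\<close> in \<open>braid_words n\<close>; this explains the membership hypotheses in the
  rules about it.\<close>

definition Br :: "nat \<Rightarrow> braid_word \<Rightarrow> braid" where
  "Br n w = abs_braid (n, w)"

lemma braid_cases:
  obtains n w where "b = Br n w" "w \<in> braid_words n"
proof -
  obtain x where x: "braid_rel x x" "b = abs_braid x"
    using Quotient_braid by (metis Quotient_abs_rep Quotient_rep_reflp)
  obtain n w where "x = (n, w)" by force
  with x that show thesis
    by (auto simp: Br_def braid_rel_def dest: braid_eq_words)
qed

lemma Br_eqI: "braid_eq n w w' \<Longrightarrow> Br n w = Br n w'"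
  unfolding Br_def
  by (intro Quotient_rel_abs[OF Quotient_braid]) (simp add: braid_rel_def)

lemma Br_eqD:
  assumes "Br n w = Br m v" "w \<in> braid_words n" "v \<in> braid_words m"
  shows "n = m \<and> braid_eq n w v"
proof -
  have "braid_rel (n, w) (n, w)" "braid_rel (m, v) (m, v)"
    using assms by (auto simp: braid_rel_def intro: braid_eq.refl)
  then have "braid_rel (n, w) (m, v)"
    using assms(1) Quotient_rel[OF Quotient_braid, of "(n, w)" "(m, v)"] by (simp add: Br_def)
  then show ?thesis by (auto simp: braid_rel_def)
qed

lemma strands_Br [simp]: "w \<in> braid_words n \<Longrightarrow> strands (Br n w) = n"
  unfolding Br_def by (subst strands.abs_eq) (auto simp: eq_onp_def braid_rel_def intro: braid_eq.refl)

lemma braid_id_Br: "braid_id n = Br n []"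
  by (simp add: Br_def braid_id.abs_eq)

lemma braid_comp_Br [simp]:
  "w \<in> braid_words n \<Longrightarrow> v \<in> braid_words n \<Longrightarrow> braid_comp (Br n w) (Br n v) = Br n (v @ w)"
  unfolding Br_def
  by (subst braid_comp.abs_eq) (auto simp: eq_onp_def braid_rel_def intro: braid_eq.refl)

lemma braid_tensor_Br [simp]:
  "w \<in> braid_words m \<Longrightarrow> v \<in> braid_words n \<Longrightarrow>
   braid_tensor (Br m w) (Br n v) = Br (m + n) (w @ shift m v)"
  unfolding Br_def
  by (subst braid_tensor.abs_eq) (auto simp: eq_onp_def braid_rel_def intro: braid_eq.refl)

abbreviation pos :: "nat list \<Rightarrow> braid_word" where
  "pos \<equiv> map (\<lambda>i. (i, True))"

lemma braiding_Br: "braiding m n = Br (m + n) (pos (crossing m n))"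
  by (simp add: Br_def braiding.abs_eq)

lemma pos_words [simp]: "pos u \<in> braid_words n \<longleftrightarrow> (\<forall>i\<in>set u. Suc i < n)"
  by (auto simp: braid_words_def)

lemma Nil_words [simp]: "[] \<in> braid_words n"
  by (simp add: braid_words_def)

lemma Cons_words [simp]: "(i, e) # w \<in> braid_words n \<longleftrightarrow> Suc i < n \<and> w \<in> braid_words n"
  by (auto simp: braid_words_def)

declare append_words [simp] shift_words [simp] widen_words [simp]

lemma shift_simps [simp]:
  "shift m [] = []" "shift m ((i, e) # w) = (m + i, e) # shift m w"
  "shift m (u @ w) = shift m u @ shift m w" "shift m (shift n w) = shift (m + n) w"
  "shift 0 w = w"
  by (auto simp: shift_def)

lemma shift_pos: "shift m (pos u) = pos (map ((+) m) u)"
  by (simp add: shift_def)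

section \<open>Inverses and commutation of distant letters\<close>

lemma braid_eq_context:
  assumes "braid_eq n u u'" "x \<in> braid_words n" "y \<in> braid_words n"
  shows "braid_eq n (x @ u @ y) (x @ u' @ y)"
  using assms by (intro braid_eq_append_left braid_eq_append_right)

text \<open>The inverse is the reversed word with all signs flipped, built one letter at a
  time.\<close>

lemma braid_inverse:
  assumes "w \<in> braid_words n"
  shows "\<exists>v\<in>braid_words n. braid_eq n (w @ v) [] \<and> braid_eq n (v @ w) []"
  using assms
proof (induction w)
  case Nil
  then show ?case by (intro bexI[of _ "[]"]) (auto intro: braid_eq.refl)
next
  case (Cons a w)
  obtain i e where a: "a = (i, e)" by force
  with Cons obtain v where v: "v \<in> braid_words n" "braid_eq n (w @ v) []" "braid_eq n (v @ w) []"
    and i: "Suc i < n" "w \<in> braid_words n" by auto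
  have "braid_eq n ([a] @ (w @ v) @ [(i, \<not> e)]) ([a] @ [] @ [(i, \<not> e)])"
    using v i a by (intro braid_eq_context) auto
  moreover have "braid_eq n ([] @ [(i, e), (i, \<not> e)] @ []) ([] @ [])"
    using i by (intro braid_eq.cancel) auto
  ultimately have 1: "braid_eq n ((a # w) @ (v @ [(i, \<not> e)])) []"
    using a by (auto intro: braid_eq.trans)
  have "braid_eq n (v @ [(i, \<not> e), (i, \<not> \<not> e)] @ w) (v @ w)"
    using i v by (intro braid_eq.cancel) auto
  then have 2: "braid_eq n ((v @ [(i, \<not> e)]) @ (a # w)) []"
    using v a by (auto intro: braid_eq.trans)
  show ?case
    using 1 2 v i by (intro bexI[of _ "v @ [(i, \<not> e)]"]) auto
qed

text \<open>Multiplying the relation by the inverse letters on both sides exchanges the roles of the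
  letter and its inverse. Sliding rules therefore need to be checked for positive letters
  only.\<close>

lemma slide_inverse_letter:
  assumes "braid_eq n ([(i, True)] @ c) (c @ [(j, True)])"
  shows "braid_eq n ([(i, e)] @ c) (c @ [(j, e)])"
proof (cases e)
  case False
  have w: "Suc i < n" "Suc j < n" "c \<in> braid_words n"
    using braid_eq_words[OF assms] by auto
  have "braid_eq n ([(i, False)] @ (c @ [(j, True)]) @ [(j, False)])
      ([(i, False)] @ ([(i, True)] @ c) @ [(j, False)])"
    using braid_eq.sym[OF assms] w by (intro braid_eq_context) auto
  moreover have "braid_eq n (([(i, False)] @ c) @ [(j, True), (j, \<not> True)] @ []) (([(i, False)] @ c) @ [])"
    using w by (intro braid_eq.cancel) auto
  moreover have "braid_eq n ([] @ [(i, False), (i, \<not> False)] @ (c @ [(j, False)])) ([] @ (c @ [(j, False)]))"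
    using w by (intro braid_eq.cancel) auto
  ultimately show ?thesis
    using False by (auto intro: braid_eq.trans braid_eq.sym)
qed (use assms in auto)

text \<open>The presentation has this relation for two positive letters;
  \<open>slide_inverse_letter\<close>, applied once to each letter, yields all signs.\<close>

lemma far_letters:
  assumes "Suc i < j" "Suc j < n"
  shows "braid_eq n ([(i, d)] @ [(j, e)]) ([(j, e)] @ [(i, d)])"
proof -
  have "braid_eq n ([] @ [(i, True), (j, True)] @ []) ([] @ [(j, True), (i, True)] @ [])"
    using assms by (intro braid_eq.far) auto
  then have "braid_eq n ([(i, True)] @ [(j, True)]) ([(j, True)] @ [(i, True)])" by simp
  then have "braid_eq n ([(j, True)] @ [(i, d)]) ([(i, d)] @ [(j, True)])"
    by (rule braid_eq.sym[OF slide_inverse_letter])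
  then show ?thesis
    by (rule braid_eq.sym[OF slide_inverse_letter])
qed

lemma far_letter_word:
  assumes "\<And>j e. (j, e) \<in> set v \<Longrightarrow> Suc i < j" "v \<in> braid_words n" "Suc i < n"
  shows "braid_eq n ([(i, d)] @ v) (v @ [(i, d)])"
  using assms
proof (induction v)
  case Nil
  then show ?case by (auto intro: braid_eq.refl)
next
  case (Cons a v)
  obtain j e where a: "a = (j, e)" by force
  have j: "Suc i < j" "Suc j < n" "v \<in> braid_words n" using Cons.prems a by auto
  have "braid_eq n ([] @ ([(i, d)] @ [(j, e)]) @ v) ([] @ ([(j, e)] @ [(i, d)]) @ v)"
    using j by (intro braid_eq_context far_letters) auto
  moreover have "braid_eq n ([(j, e)] @ ([(i, d)] @ v)) ([(j, e)] @ (v @ [(i, d)]))"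
    using j Cons.prems by (intro braid_eq_append_left Cons.IH) auto
  ultimately show ?case
    using a by (auto intro: braid_eq.trans)
qed

lemma far_words:
  assumes "\<And>i d j e. (i, d) \<in> set u \<Longrightarrow> (j, e) \<in> set v \<Longrightarrow> Suc i < j"
    "u \<in> braid_words n" "v \<in> braid_words n"
  shows "braid_eq n (u @ v) (v @ u)"
  using assms
proof (induction u)
  case Nil
  then show ?case by (auto intro: braid_eq.refl)
next
  case (Cons a u)
  obtain i d where a: "a = (i, d)" by force
  have w: "Suc i < n" "u \<in> braid_words n" using Cons.prems a by auto
  have "braid_eq n ([a] @ (u @ v)) ([a] @ (v @ u))"
    using Cons.prems w a by (intro braid_eq_append_left Cons.IH) auto
  moreover have "braid_eq n (([(i, d)] @ v) @ u) ((v @ [(i, d)]) @ u)"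
    using Cons.prems w a by (intro braid_eq_append_right far_letter_word) auto
  ultimately show ?case
    using a by (auto intro: braid_eq.trans)
qed

text \<open>Juxtaposed braids act on disjoint sets of strands. This is the source of the
  functoriality of the tensor product.\<close>

lemma disjoint_words_commute:
  assumes "u \<in> braid_words m" "v \<in> braid_words n"
  shows "braid_eq (m + n) (u @ shift m v) (shift m v @ u)"
proof (rule far_words)
  show "Suc i < j" if "(i, d) \<in> set u" "(j, e) \<in> set (shift m v)" for i d j e
    using assms(1) that by (fastforce simp: braid_words_def shift_def)
qed (use assms in auto)

section \<open>The braiding\<close>

text \<open>The letter \<open>Suc j\<close>, with \<open>j = a + i\<close>, passes the part of the
  run below \<open>j\<close> by far commutation, turns into \<open>j\<close> by the braid relation,
  and passes the rest by far commutation.\<close>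

lemma slide_up:
  assumes "Suc i < n" "a + n < N"
  shows "braid_eq N (pos (Suc (a + i) # [a..<a + n])) (pos ([a..<a + n] @ [a + i]))"
proof -
  define j where "j = a + i"
  define P where "P = [a..<j]"
  define R where "R = [Suc (Suc j)..<a + n]"
  have split: "[a..<a + n] = P @ [j, Suc j] @ R"
  proof -
    have "[a..<a + n] = [a..<j] @ [j..<a + n]"
      using assms upt_add_eq_append[of a j "n - i"] by (simp add: j_def)
    moreover have "[j..<a + n] = j # Suc j # R"
      using assms by (simp add: j_def R_def upt_conv_Cons)
    ultimately show ?thesis by (simp add: P_def)
  qed
  have w: "pos P \<in> braid_words N" "pos R \<in> braid_words N" "Suc (Suc j) < N"
    using assms by (auto simp: P_def R_def j_def)
  have "braid_eq N (pos [Suc j] @ pos P) (pos P @ pos [Suc j])"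
    using w by (intro braid_eq.sym[OF far_words]) (auto simp: P_def)
  then have "braid_eq N ((pos [Suc j] @ pos P) @ pos ([j, Suc j] @ R)) ((pos P @ pos [Suc j]) @ pos ([j, Suc j] @ R))"
    using w by (intro braid_eq_append_right) auto
  moreover have "braid_eq N (pos P @ [(Suc j, True), (j, True), (Suc j, True)] @ pos R)
     (pos P @ [(j, True), (Suc j, True), (j, True)] @ pos R)"
    using w by (intro braid_eq.sym[OF braid_eq.braid]) auto
  moreover have "braid_eq N (pos (P @ [j, Suc j]) @ (pos [j] @ pos R)) (pos (P @ [j, Suc j]) @ (pos R @ pos [j]))"
    using w by (intro braid_eq_append_left far_words) (auto simp: R_def)
  ultimately show ?thesis
    unfolding split j_def[symmetric] by (auto intro: braid_eq.trans)
qed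

text \<open>Mirror image of \<open>slide_up\<close>: on a descending run, which is
  \<open>crossing m 1\<close>, the braid relation raises the index instead of lowering it.\<close>

lemma slide_down:
  assumes "Suc i < m" "m < N"
  shows "braid_eq N (pos (i # rev [0..<m])) (pos (rev [0..<m] @ [Suc i]))"
proof -
  define P where "P = rev [0..<i]"
  define R where "R = rev [Suc (Suc i)..<m]"
  have split: "rev [0..<m] = R @ [Suc i, i] @ P"
  proof -
    have "[0..<m] = [0..<i] @ [i..<m]"
      using assms upt_add_eq_append[of 0 i "m - i"] by simp
    moreover have "[i..<m] = i # Suc i # [Suc (Suc i)..<m]"
      using assms by (simp add: upt_conv_Cons)
    ultimately show ?thesis by (simp add: P_def R_def)
  qed
  have w: "pos P \<in> braid_words N" "pos R \<in> braid_words N" "Suc (Suc i) < N"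
    using assms by (auto simp: P_def R_def)
  have "braid_eq N ((pos [i] @ pos R) @ pos ([Suc i, i] @ P)) ((pos R @ pos [i]) @ pos ([Suc i, i] @ P))"
    using w by (intro braid_eq_append_right far_words) (auto simp: R_def)
  moreover have "braid_eq N (pos R @ [(i, True), (Suc i, True), (i, True)] @ pos P)
     (pos R @ [(Suc i, True), (i, True), (Suc i, True)] @ pos P)"
    using w by (intro braid_eq.braid) auto
  moreover have "braid_eq N (pos (R @ [Suc i, i]) @ (pos [Suc i] @ pos P)) (pos (R @ [Suc i, i]) @ (pos P @ pos [Suc i]))"
    using w by (intro braid_eq_append_left braid_eq.sym[OF far_words]) (auto simp: P_def)
  ultimately show ?thesis
    unfolding split by (auto intro: braid_eq.trans)
qed

lemma crossing_words [simp]: "pos (crossing m n) \<in> braid_words (m + n)"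
  by (auto dest: crossing_bound)

lemma crossing_0 [simp]: "crossing m 0 = []"
  by (induction m) auto

lemma crossing_1: "crossing m (Suc 0) = rev [0..<m]"
  by (induction m) auto

lemma map_plus_upt: "map ((+) a) [m..<n] = [a + m..<a + n]" for a :: nat
  by (rule nth_equalityI) auto

text \<open>This holds for the words themselves because \<open>crossing\<close> recurses on its
  first argument; splitting the second argument requires braid relations.\<close>

lemma crossing_add_left:
  "crossing (m' + m) n = map ((+) m') (crossing m n) @ crossing m' n"
proof (induction m)
  case (Suc m)
  have "map ((+) m') [m..<m + n] = [m' + m..<m' + m + n]"
    by (simp add: map_plus_upt add.assoc)
  with Suc show ?case by (simp add: add.assoc)
qed simp

lemma crossing_add_right:
  "braid_eq (m + (n' + n)) (pos (crossing m (n' + n)))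
     (pos (crossing m n' @ map ((+) n') (crossing m n)))"
proof (induction m)
  case 0
  then show ?case by (auto intro: braid_eq.refl)
next
  case (Suc m)
  let ?N = "Suc m + (n' + n)" and ?P = "[m..<m + n']" and ?Q = "[m + n'..<m + n' + n]"
    and ?X = "crossing m n'" and ?Y = "map ((+) n') (crossing m n)"
  have up: "[m..<m + (n' + n)] = ?P @ ?Q"
    by (metis add.assoc le_add1 upt_add_eq_append)
  have X: "Suc i < m + n'" if "i \<in> set ?X" for i
    using that by (rule crossing_bound)
  have Y: "Suc i < m + (n' + n)" if "i \<in> set ?Y" for i
    using that by (auto dest: crossing_bound)
  have w: "pos ?P \<in> braid_words ?N" "pos ?Q \<in> braid_words ?N" "pos ?X \<in> braid_words ?N"
     "pos ?Y \<in> braid_words ?N"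
    by (auto simp del: map_map dest: X Y crossing_bound Suc_lessD)
  have "braid_eq ?N (pos (crossing m (n' + n))) (pos (?X @ ?Y))"
    using braid_eq_widen[OF Suc, of 1] by simp
  then have 1: "braid_eq ?N (pos (?P @ ?Q) @ pos (crossing m (n' + n))) (pos (?P @ ?Q) @ pos (?X @ ?Y))"
    using w by (intro braid_eq_append_left) auto
  \<comment> \<open>The second half \<open>?Q\<close> of the new row has to move past
    \<open>?X\<close>, whose letters all lie at least two below those of \<open>?Q\<close>.\<close>
  have "braid_eq ?N (pos ?Q @ pos ?X) (pos ?X @ pos ?Q)"
    using w X by (intro braid_eq.sym[OF far_words]) fastforce+
  then have 2: "braid_eq ?N (pos ?P @ (pos ?Q @ pos ?X) @ pos ?Y) (pos ?P @ (pos ?X @ pos ?Q) @ pos ?Y)"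
    using w by (intro braid_eq_context)
  have "map ((+) n') [m..<m + n] = ?Q"
    by (simp add: map_plus_upt add.assoc add.commute add.left_commute)
  then show ?case
    using braid_eq.trans[OF 1[unfolded append_assoc[symmetric] map_append] 2[unfolded append_assoc[symmetric]]] up
    by simp
qed

section \<open>Naturality of the crossing in both arguments\<close>

lemma crossing_natural_right_letter:
  assumes "Suc i < n"
  shows "braid_eq (m + n) ([(m + i, True)] @ pos (crossing m n)) (pos (crossing m n) @ [(i, True)])"
proof (induction m)
  case 0
  then show ?case using assms by (auto intro: braid_eq.refl)
next
  case (Suc m)
  let ?N = "Suc m + n"
  \<comment> \<open>The induction hypothesis lives on one strand fewer, hence
    \<open>braid_eq_widen\<close>. Each new row lowers the index of the letter by one, through
    \<open>slide_up\<close>.\<close>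
  have w: "pos (crossing m n) \<in> braid_words ?N" "pos [m..<m + n] \<in> braid_words ?N"
    using braid_eq_words[OF braid_eq_widen[OF Suc, of 1]] by auto
  have "braid_eq ?N (pos (Suc (m + i) # [m..<m + n]) @ pos (crossing m n))
      (pos ([m..<m + n] @ [m + i]) @ pos (crossing m n))"
    using assms w by (intro braid_eq_append_right slide_up) auto
  moreover have "braid_eq ?N (pos [m..<m + n] @ ([(m + i, True)] @ pos (crossing m n)))
      (pos [m..<m + n] @ (pos (crossing m n) @ [(i, True)]))"
    using w braid_eq_widen[OF Suc, of 1] by (intro braid_eq_append_left) auto
  ultimately show ?case by (auto intro: braid_eq.trans)
qed

text \<open>Induction on the second argument: \<open>crossing_add_right\<close> splits off the
  crossing past one more strand, a descending run that raises the letter by one through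
  \<open>slide_down\<close>.\<close>

lemma crossing_natural_left_letter:
  assumes "Suc i < m"
  shows "braid_eq (m + n) ([(i, True)] @ pos (crossing m n)) (pos (crossing m n) @ [(n + i, True)])"
proof (induction n)
  case 0
  then show ?case using assms by (auto intro: braid_eq.refl)
next
  case (Suc n)
  let ?N = "m + Suc n" and ?Y = "pos (map ((+) n) (rev [0..<m]))"
  have split: "braid_eq ?N (pos (crossing m (Suc n))) (pos (crossing m n) @ ?Y)"
    using crossing_add_right[of m n 1] by (simp add: crossing_1)
  have w: "pos (crossing m n) \<in> braid_words ?N" "?Y \<in> braid_words ?N"
    using braid_eq_words[OF split] by auto
  have "braid_eq (n + Suc m) (shift n (pos (i # rev [0..<m]))) (shift n (pos (rev [0..<m] @ [Suc i])))"
    using assms by (intro braid_eq_shift slide_down) auto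
  then have slide: "braid_eq ?N ([(n + i, True)] @ ?Y) (?Y @ [(Suc n + i, True)])"
    by (simp add: shift_pos add.commute)
  have "braid_eq ?N ([(i, True)] @ pos (crossing m (Suc n))) ([(i, True)] @ (pos (crossing m n) @ ?Y))"
    using split assms by (intro braid_eq_append_left) auto
  moreover have "braid_eq ?N (([(i, True)] @ pos (crossing m n)) @ ?Y) ((pos (crossing m n) @ [(n + i, True)]) @ ?Y)"
    using braid_eq_widen[OF Suc, of 1] w by (intro braid_eq_append_right) auto
  moreover have "braid_eq ?N (pos (crossing m n) @ ([(n + i, True)] @ ?Y)) (pos (crossing m n) @ (?Y @ [(Suc n + i, True)]))"
    using slide w by (intro braid_eq_append_left) auto
  moreover have "braid_eq ?N ((pos (crossing m n) @ ?Y) @ [(Suc n + i, True)]) (pos (crossing m (Suc n)) @ [(Suc n + i, True)])"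
    using split assms by (intro braid_eq_append_right braid_eq.sym[OF split]) auto
  ultimately show ?case by (auto intro: braid_eq.trans)
qed

text \<open>Passage from positive letters to all words. The two offsets \<open>a\<close> and
  \<open>b\<close> cover both naturality statements, since a shift by 0 is trivial.\<close>

lemma slide_word:
  assumes "\<And>i. Suc i < k \<Longrightarrow> braid_eq N ([(a + i, True)] @ c) (c @ [(b + i, True)])"
    "c \<in> braid_words N" "a + k \<le> N" "b + k \<le> N" "v \<in> braid_words k"
  shows "braid_eq N (shift a v @ c) (c @ shift b v)"
  using assms(5)
proof (induction v)
  case Nil
  show ?case using assms(2) by (simp add: braid_eq.refl)
next
  case (Cons x v)
  obtain i e where x: "x = (i, e)" by force
  have v: "Suc i < k" "v \<in> braid_words k" using Cons.prems x by auto
  have w: "shift d v \<in> braid_words N" if "d + k \<le> N" for d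
    using widen_words[OF shift_words[OF v(2)], of d "N - (d + k)"] that by simp
  have "braid_eq N ([(a + i, e)] @ (shift a v @ c)) ([(a + i, e)] @ (c @ shift b v))"
    using Cons.IH v assms(3) by (intro braid_eq_append_left) auto
  moreover have "braid_eq N (([(a + i, e)] @ c) @ shift b v) ((c @ [(b + i, e)]) @ shift b v)"
    using w assms(4) v(1) by (intro braid_eq_append_right[OF slide_inverse_letter[OF assms(1)]]) auto
  ultimately show ?case using x by (auto intro: braid_eq.trans)
qed

text \<open>First \<open>v\<close> and then \<open>u\<close> moves through the crossing. They emerge
  on disjoint strands in the wrong temporal order and are then swapped.\<close>

lemma crossing_natural:
  assumes "u \<in> braid_words m" "v \<in> braid_words n"
  shows "braid_eq (m + n) (u @ shift m v @ pos (crossing m n)) (pos (crossing m n) @ v @ shift n u)"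
proof -
  let ?c = "pos (crossing m n)"
  have w: "shift n u \<in> braid_words (m + n)" "v \<in> braid_words (m + n)"
    using shift_words[OF assms(1), of n] widen_words[OF assms(2), of m] by (simp_all only: add.commute)
  have "braid_eq (m + n) (shift m v @ ?c) (?c @ shift 0 v)"
    using crossing_natural_right_letter[of _ n m] assms(2)
    by (intro slide_word[of n]) (simp_all del: pos_words)
  then have 1: "braid_eq (m + n) (u @ (shift m v @ ?c)) (u @ (?c @ v))"
    using widen_words[OF assms(1), of n] by (simp add: braid_eq_append_left)
  have "braid_eq (m + n) (shift 0 u @ ?c) (?c @ shift n u)"
    using crossing_natural_left_letter[of _ m n] assms(1)
    by (intro slide_word[of m]) (simp_all del: pos_words)
  then have 2: "braid_eq (m + n) ((u @ ?c) @ v) ((?c @ shift n u) @ v)"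
    using w by (simp add: braid_eq_append_right del: append_assoc)
  have "braid_eq (m + n) (shift n u @ v) (v @ shift n u)"
    using braid_eq.sym[OF disjoint_words_commute[OF assms(2,1)]] by (simp only: add.commute)
  then have 3: "braid_eq (m + n) (?c @ (shift n u @ v)) (?c @ (v @ shift n u))"
    by (rule braid_eq_append_left) (rule crossing_words)
  show ?thesis
    using braid_eq.trans[OF braid_eq.trans[OF 1 2[unfolded append_assoc]] 3] by simp
qed

section \<open>The free braided monoidal category\<close>

lemma strands_braid_id [simp]: "strands (braid_id n) = n"
  by (simp add: braid_id_Br)

lemma strands_braid_comp [simp]: "strands b = strands c \<Longrightarrow> strands (braid_comp b c) = strands c"
  by (cases b rule: braid_cases; cases c rule: braid_cases) auto

lemma strands_braid_tensor [simp]: "strands (braid_tensor b c) = strands b + strands c"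
  by (cases b rule: braid_cases; cases c rule: braid_cases) auto

lemma strands_braiding [simp]: "strands (braiding m n) = m + n"
  by (simp add: braiding_Br del: pos_words)

lemma braid_comp_assoc:
  "strands b = strands c \<Longrightarrow> strands c = strands d \<Longrightarrow>
   braid_comp (braid_comp b c) d = braid_comp b (braid_comp c d)"
  by (cases b rule: braid_cases; cases c rule: braid_cases; cases d rule: braid_cases) auto

lemma braid_comp_id [simp]:
  "strands b = n \<Longrightarrow> braid_comp b (braid_id n) = b"
  "strands b = n \<Longrightarrow> braid_comp (braid_id n) b = b"
  by (cases b rule: braid_cases; auto simp: braid_id_Br)+

lemma braid_tensor_assoc:
  "braid_tensor (braid_tensor b c) d = braid_tensor b (braid_tensor c d)"
  by (cases b rule: braid_cases; cases c rule: braid_cases; cases d rule: braid_cases)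
    (auto simp: add.assoc)

lemma braid_tensor_id_0 [simp]:
  "braid_tensor b (braid_id 0) = b" "braid_tensor (braid_id 0) b = b"
  by (cases b rule: braid_cases; auto simp: braid_id_Br)+

lemma braid_tensor_id [simp]: "braid_tensor (braid_id m) (braid_id n) = braid_id (m + n)"
  by (simp add: braid_id_Br)

lemma braid_interchange:
  assumes "strands d = strands c" "strands b = strands a"
  shows "braid_tensor (braid_comp d c) (braid_comp b a) =
    braid_comp (braid_tensor d b) (braid_tensor c a)"
proof -
  obtain m x y where c: "c = Br m x" "d = Br m y" "x \<in> braid_words m" "y \<in> braid_words m"
    using assms(1) by (cases c rule: braid_cases; cases d rule: braid_cases) auto
  obtain n u v where a: "a = Br n u" "b = Br n v" "u \<in> braid_words n" "v \<in> braid_words n"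
    using assms(2) by (cases a rule: braid_cases; cases b rule: braid_cases) auto
  \<comment> \<open>The two sides differ only in the order of \<open>y\<close> and
    \<open>shift m u\<close>, which lie on disjoint strands.\<close>
  have "braid_eq (m + n) (x @ (y @ shift m u) @ shift m v) (x @ (shift m u @ y) @ shift m v)"
    using c a by (intro braid_eq_context disjoint_words_commute) auto
  then show ?thesis
    using c a by (auto intro!: Br_eqI)
qed

lemma braid_invertible:
  "\<exists>c. strands c = strands b \<and> braid_comp c b = braid_id (strands b) \<and>
     braid_comp b c = braid_id (strands b)"
proof -
  obtain n w where b: "b = Br n w" "w \<in> braid_words n" by (rule braid_cases)
  then obtain v where "v \<in> braid_words n" "braid_eq n (w @ v) []" "braid_eq n (v @ w) []"
    using braid_inverse by blast
  then show ?thesis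
    using b by (intro exI[of _ "Br n v"]) (simp add: braid_id_Br Br_eqI)
qed

lemma braiding_natural:
  "braid_comp (braiding (strands b) (strands c)) (braid_tensor b c) =
   braid_comp (braid_tensor c b) (braiding (strands b) (strands c))"
proof -
  obtain m u where b: "b = Br m u" "u \<in> braid_words m" by (rule braid_cases)
  obtain n v where c: "c = Br n v" "v \<in> braid_words n" by (rule braid_cases)
  have w: "v @ shift n u \<in> braid_words (m + n)"
    using braid_eq_words[OF crossing_natural[OF b(2) c(2)]] by simp
  have comm: "n + m = m + n" by simp
  show ?thesis
    using b c w crossing_natural[OF b(2) c(2)]
    by (simp add: braiding_Br comm Br_eqI del: pos_words)
qed

lemma braiding_0 [simp]: "braiding 0 n = braid_id n" "braiding n 0 = braid_id n"
  by (simp_all add: braiding_Br braid_id_Br)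

text \<open>One of the two hexagon identities, with strict associativity;
  \<open>braiding_add_right\<close> is the other. They become the compatibility of the interchanger
  with composition of 2-cells.\<close>

lemma braiding_add_left:
  "braiding (m' + m) n =
   braid_comp (braid_tensor (braiding m' n) (braid_id m)) (braid_tensor (braid_id m') (braiding m n))"
proof -
  have "pos (crossing m' n) \<in> braid_words (m' + (m + n))"
    using widen_words[OF crossing_words[of m' n], of m] by (simp only: ac_simps)
  moreover have "shift m' (pos (crossing m n)) \<in> braid_words (m' + (m + n))"
    by (rule shift_words[OF crossing_words])
  ultimately show ?thesis
    by (simp add: braiding_Br braid_id_Br crossing_add_left shift_pos add.assoc add.commute[of n m]
      del: pos_words map_map)
qed

lemma braiding_add_right:
  "braiding m (n' + n) =
   braid_comp (braid_tensor (braid_id n') (braiding m n)) (braid_tensor (braiding m n') (braid_id n))"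
proof -
  have "pos (crossing m n') \<in> braid_words (m + (n' + n))"
    using widen_words[OF crossing_words[of m n'], of n] by (simp only: ac_simps)
  moreover have "pos (map ((+) n') (crossing m n)) \<in> braid_words (m + (n' + n))"
    using shift_words[OF crossing_words[of m n], of n'] by (simp only: shift_pos ac_simps)
  ultimately show ?thesis
    using Br_eqI[OF crossing_add_right[of m n' n]]
    by (simp add: braiding_Br braid_id_Br shift_pos add.assoc add.left_commute[of n' m]
      del: pos_words map_map)
qed

section \<open>The underlying permutation as an invariant of braids\<close>

text \<open>\<open>position w x\<close> is the final position of the strand that starts in position \<open>x\<close>.\<close>

primrec position :: "braid_word \<Rightarrow> nat \<Rightarrow> nat" where
  "position [] x = x"
| "position (a # w) x =
    position w (if x = fst a then Suc x else if x = Suc (fst a) then fst a else x)"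

lemma position_append [simp]: "position (u @ v) x = position v (position u x)"
  by (induction u arbitrary: x) auto

text \<open>The transpositions of adjacent positions satisfy the defining relations. A letter and
  its inverse give the same transposition, so \<open>cancel\<close> is respected too.\<close>

lemma position_braid_eq: "braid_eq n w w' \<Longrightarrow> position w = position w'"
  by (induction rule: braid_eq.induct) (auto simp: fun_eq_iff)

lemma tensor_not_symmetric:
  "braid_tensor (Br 2 [(0, True)]) (braid_id 2) \<noteq> braid_tensor (braid_id 2) (Br 2 [(0, True)])"
proof
  assume "braid_tensor (Br 2 [(0, True)]) (braid_id 2) = braid_tensor (braid_id 2) (Br 2 [(0, True)])"
  then have "braid_eq 4 [(0, True)] [(2, True)]"
    using Br_eqD[of 4 "[(0, True)]" 4 "[(2, True)]"] by (simp add: braid_id_Br)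
  \<comment> \<open>The strand starting in position 0 ends in position 1 under the first word and
    stays in place under the second.\<close>
  then have "position [(0, True)] 0 = position [(2, True)] 0"
    by (metis position_braid_eq)
  then show False by simp
qed

section \<open>The Gray-category of braids\<close>

lemma braid_gray_simps [simp]:
  "cells braid_gray = b_cells" "src braid_gray k = b_bdry" "tgt braid_gray k = b_bdry"
  "idt braid_gray k = b_idt" "comp braid_gray m = b_comp" "ichg braid_gray = b_ichg"
  by (simp_all add: braid_gray_def)

lemma b_cells_numeral [simp]:
  "b_cells 1 = {Arr}" "b_cells 2 = range Two" "b_cells 3 = range Three"
  by (simp_all add: eval_nat_numeral)

lemma dim_cases:
  fixes m :: nat
  assumes "m \<le> 3"
  obtains "m = 0" | "m = 1" | "m = 2" | "m = 3"
  using assms by linarith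

lemma bsrc_braid_gray [simp]: "bsrc braid_gray k d x = (b_bdry ^^ d) x"
  by (induction d arbitrary: x) (simp_all add: funpow_swap1)

lemma btgt_braid_gray [simp]: "btgt braid_gray k d x = (b_bdry ^^ d) x"
  by (induction d arbitrary: x) (simp_all add: funpow_swap1)

lemma bidt_braid_gray [simp]: "bidt braid_gray k d x = (b_idt ^^ d) x"
  by (induction d arbitrary: x) simp_all

text \<open>There is a single cell in dimensions 0 and 1, so only composition along 2-cells carries
  a condition. Unfolding with this rule reduces the axioms to cases on dimension.\<close>

lemma composable_braid_gray:
  "composable braid_gray m k y x \<longleftrightarrow>
     m = 1 \<and> k = 0 \<and> y = Arr \<and> x = Arr \<or>
     m = 2 \<and> k < 2 \<and> (\<exists>p q. y = Two p \<and> x = Two q) \<or>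
     m = 3 \<and> k < 3 \<and> (\<exists>b c. y = Three b \<and> x = Three c \<and> (k = 2 \<longrightarrow> strands b = strands c))"
proof (cases "m \<le> 3")
  case True
  have "k = 0 \<or> k = 1 \<or> k = 2" if "k < 3" using that by linarith
  with True show ?thesis
    by (cases rule: dim_cases) (auto simp: composable_def eval_nat_numeral less_Suc_eq)
qed (auto simp: composable_def)

lemma funpow_2: "(f ^^ 2) x = f (f x)"
  by (simp add: eval_nat_numeral)

text \<open>The iterated identities on \<open>Arr\<close> are 0 and the braid on no strands, the
  units of the tensor product; hence whiskering does nothing.\<close>

lemma whl_braid_gray [simp]:
  "whl braid_gray 1 Arr Arr = Arr" "whl braid_gray (Suc 0) Arr Arr = Arr"
  "whl braid_gray 2 Arr (Two n) = Two n" "whl braid_gray 3 Arr (Three b) = Three b"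
  by (simp_all add: whl_def eval_nat_numeral)

lemma whr_braid_gray [simp]:
  "whr braid_gray 1 Arr Arr = Arr" "whr braid_gray (Suc 0) Arr Arr = Arr"
  "whr braid_gray 2 (Two n) Arr = Two n" "whr braid_gray 3 (Three b) Arr = Three b"
  by (simp_all add: whr_def eval_nat_numeral)

lemma rgset_braid_gray: "rgset braid_gray"
proof -
  have "b_bdry x \<in> b_cells (k - 1)" if "1 \<le> k" "k \<le> 3" "x \<in> b_cells k" for k x
    using that(2,1,3) by (cases rule: dim_cases) auto
  moreover have "b_idt x \<in> b_cells (k + 1) \<and> b_bdry (b_idt x) = x" if "k \<le> 2" "x \<in> b_cells k" for k x
  proof -
    have "k \<le> 3" using that by simp
    then show ?thesis using that by (cases rule: dim_cases) auto
  qed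
  ultimately show ?thesis unfolding rgset_def braid_gray_simps by blast
qed

lemma magma_braid_gray: "magma braid_gray"
  unfolding magma_def composable_braid_gray
  by (auto simp: rgset_braid_gray less_Suc_eq numeral_eq_Suc)

lemma hom_2_categories_braid_gray: "hom_2_categories braid_gray"
proof -
  have "b_comp k x ((b_idt ^^ (m - k)) ((b_bdry ^^ (m - k)) x)) = x \<and>
      b_comp k ((b_idt ^^ (m - k)) ((b_bdry ^^ (m - k)) x)) x = x"
    if "1 \<le> k" "k < m" "m \<le> 3" "x \<in> b_cells m" for m k x
  proof -
    have "m = 2 \<and> k = 1 \<or> m = 3 \<and> k = 1 \<or> m = 3 \<and> k = 2"
      using that by linarith
    with that(4) show ?thesis by (auto simp: eval_nat_numeral)
  qed
  then show ?thesis
    unfolding hom_2_categories_def composable_braid_gray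
    by (auto simp: braid_comp_assoc braid_tensor_assoc braid_interchange)
qed

lemma b_bdry_0:
  "x \<in> b_cells m \<Longrightarrow> m \<le> 3 \<Longrightarrow> (b_bdry ^^ m) x = Pt"
  by (erule dim_cases) (auto simp: eval_nat_numeral)

lemma whisker_braid_gray:
  "x \<in> b_cells m \<Longrightarrow> 1 \<le> m \<Longrightarrow> m \<le> 3 \<Longrightarrow> whl braid_gray m Arr x = x \<and> whr braid_gray m x Arr = x"
  by (erule dim_cases) auto

lemma whiskering_laws_braid_gray: "whiskering_laws braid_gray"
proof -
  have closed: "x \<in> b_cells m \<and> y \<in> b_cells m \<and> b_comp k y x \<in> b_cells m \<and> 1 \<le> m \<and> m \<le> 3"
    if "composable braid_gray m k y x" for m k y x
    using that magma_braid_gray by (auto simp: magma_def composable_def)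
  have "b_idt x \<in> b_cells (Suc m)" if "m \<le> 2" "x \<in> b_cells m" for m x
    using that rgset_braid_gray by (simp add: rgset_def)
  then show ?thesis
    unfolding whiskering_laws_def by (auto simp: whisker_braid_gray b_bdry_0 dest: closed)
qed

lemma horizontal_convention_braid_gray: "horizontal_convention braid_gray"
  unfolding horizontal_convention_def composable_braid_gray
  by (auto simp: funpow_2)

lemma interchanger_laws_braid_gray: "interchanger_laws braid_gray"
proof -
  have inv: "\<exists>\<iota>\<in>range Three. b_bdry \<iota> = Two (m + n) \<and>
      b_comp 2 \<iota> (Three (braiding m n)) = Three (braid_id (m + n)) \<and>
      b_comp 2 (Three (braiding m n)) \<iota> = Three (braid_id (m + n))" for m n
    using braid_invertible[of "braiding m n"] by auto
  show ?thesis
    unfolding interchanger_laws_def composable_braid_gray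
  \<comment> \<open>Case 4 is invertibility, case 5 naturality, and cases 8 and 9 are the hexagon
    identities. The remaining cases follow from trivial whiskering and the braiding with 0.\<close>
  proof (intro conjI allI impI, goal_cases)
    case (4 \<delta> \<gamma>)
    then show ?case using inv by (auto simp: add.commute)
  next
    case (9 \<delta>' \<delta> \<gamma>)
    then show ?case by (auto simp: braiding_add_left)
  next
    case (8 \<delta> \<gamma>' \<gamma>)
    then show ?case by (auto simp: braiding_add_right)
  next
    case (5 \<psi> \<phi>)
    then show ?case by (auto simp: funpow_2 braiding_natural)
  qed (auto simp: funpow_2 add.commute)
qed

lemma gray_category_braid_gray: "gray_category braid_gray"
  unfolding gray_category_def
  by (intro conjI magma_braid_gray hom_2_categories_braid_gray whiskering_laws_braid_gray
    horizontal_convention_braid_gray interchanger_laws_braid_gray)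

section \<open>Penon 3-categories and braids\<close>

text \<open>Common core of both nonexistence claims: it asks only for what an isomorphism of magmas
  and an isomorphism of monoidal categories both provide.\<close>

lemma penon_not_braid_category:
  assumes adj: "left_adjoint_of_forget F \<eta>" and A: "rgset A" and dd: "doubly_degenerate A"
    and u: "inj_on u (cells A 2)" and v: "bij_betw v (cells A 3) UNIV"
    and bd: "\<And>f. f \<in> cells A 3 \<Longrightarrow> u (src A 3 f) = strands (v f) \<and> u (tgt A 3 f) = strands (v f)"
    and tens: "\<And>f g. f \<in> cells A 3 \<Longrightarrow> g \<in> cells A 3 \<Longrightarrow>
      v (comp (penon_composition F \<eta> A \<theta>) 3 1 f g) = braid_tensor (v f) (v g)"
  shows False
proof -
  let ?s = "Br 2 [(0, True)]"
  obtain f where f: "f \<in> cells A 3" "v f = ?s"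
    using bij_betw_imp_surj_on[OF v] by (metis UNIV_I imageE)
  obtain g where g: "g \<in> cells A 3" "v g = braid_id 2"
    using bij_betw_imp_surj_on[OF v] by (metis UNIV_I imageE)
  have two: "src A 3 x \<in> cells A 2 \<and> tgt A 3 x \<in> cells A 2" if "x \<in> cells A 3" for x
  proof -
    have "src A 3 x \<in> cells A (3 - 1) \<and> tgt A 3 x \<in> cells A (3 - 1)"
      using A that unfolding rgset_def by (metis one_le_numeral order_refl)
    then show ?thesis by simp
  qed
  \<comment> \<open>Injectivity of \<open>u\<close> leaves only one 2-cell over 2, so
    \<open>f\<close> and \<open>g\<close> are endomorphisms of the same 2-cell, as commutation of
    their tensor product requires.\<close>
  have "x = src A 3 f" if "x \<in> cells A 2" "u x = 2" for x
    using inj_onD[OF u, of x "src A 3 f"] that two[OF f(1)] bd[OF f(1)] f(2) by simp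
  then have "comp (penon_composition F \<eta> A \<theta>) 3 1 f g = comp (penon_composition F \<eta> A \<theta>) 3 1 g f"
    using two[OF f(1)] two[OF g(1)] bd[OF f(1)] bd[OF g(1)] f g
    by (intro penon_tensor_commute[OF adj A dd, of _ "src A 3 f"]) auto
  then show False
    using tens[OF f(1) g(1)] tens[OF g(1) f(1)] f(2) g(2) tensor_not_symmetric by simp
qed

lemma penon_composition_simps [simp]:
  "cells (penon_composition F \<eta> A \<theta>) = cells A" "src (penon_composition F \<eta> A \<theta>) = src A"
  "tgt (penon_composition F \<eta> A \<theta>) = tgt A"
  by (simp_all add: penon_composition_def rgset.extend_def)

theorem mainTheorem3:
  shows "gray_category braid_gray \<and> doubly_degenerate braid_gray \<and>
    (\<forall>(F :: 'u rgset \<Rightarrow> 'u qobj) \<eta>. left_adjoint_of_forget F \<eta> \<longrightarrow>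
       (\<nexists>A \<theta> h. penon_3_category F \<eta> A \<theta> \<and> doubly_degenerate A \<and>
          magma_iso (penon_composition F \<eta> A \<theta>) braid_gray h) \<and>
       (\<nexists>A \<theta> u v. penon_3_category F \<eta> A \<theta> \<and> doubly_degenerate A \<and>
          mon_cat_iso (monoidal_of (penon_composition F \<eta> A \<theta>)) braid_category u v))"
proof (intro conjI allI impI)
  show "gray_category braid_gray" by (rule gray_category_braid_gray)
  show "doubly_degenerate braid_gray" by (simp add: doubly_degenerate_def)
  fix F :: "'u rgset \<Rightarrow> 'u qobj" and \<eta>
  assume adj: "left_adjoint_of_forget F \<eta>"
  show "\<nexists>A \<theta> u v. penon_3_category F \<eta> A \<theta> \<and> doubly_degenerate A \<and>
      mon_cat_iso (monoidal_of (penon_composition F \<eta> A \<theta>)) braid_category u v"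
  proof clarify
    fix A \<theta> u v
    assume A: "penon_3_category F \<eta> A \<theta>" "doubly_degenerate A"
      and iso: "mon_cat_iso (monoidal_of (penon_composition F \<eta> A \<theta>)) braid_category u v"
    show False
    proof (rule penon_not_braid_category[OF adj])
      show "rgset A" using A by (simp add: penon_3_category_def)
      show "inj_on u (cells A 2)" "bij_betw v (cells A 3) UNIV"
        using iso by (auto simp: mon_cat_iso_def monoidal_of_def braid_category_def bij_betw_def)
      show "u (src A 3 f) = strands (v f) \<and> u (tgt A 3 f) = strands (v f)" if "f \<in> cells A 3" for f
        using iso that by (auto simp: mon_cat_iso_def monoidal_of_def braid_category_def)
      show "v (comp (penon_composition F \<eta> A \<theta>) 3 1 f g) = braid_tensor (v f) (v g)"
        if "f \<in> cells A 3" "g \<in> cells A 3" for f g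
        using iso that by (auto simp: mon_cat_iso_def monoidal_of_def braid_category_def)
    qed (rule A)
  qed
  show "\<nexists>A \<theta> h. penon_3_category F \<eta> A \<theta> \<and> doubly_degenerate A \<and>
      magma_iso (penon_composition F \<eta> A \<theta>) braid_gray h"
  proof clarify
    fix A \<theta> h
    assume A: "penon_3_category F \<eta> A \<theta>" and dd: "doubly_degenerate A"
      and iso: "magma_iso (penon_composition F \<eta> A \<theta>) braid_gray h"
    let ?P = "penon_composition F \<eta> A \<theta>"
    have rg: "rgset A" using A by (simp add: penon_3_category_def)
    have st: "src A k x \<in> cells A (k - 1) \<and> tgt A k x \<in> cells A (k - 1)"
      if "1 \<le> k" "k \<le> 3" "x \<in> cells A k" for k x
      using rg that by (simp add: rgset_def)
    \<comment> \<open>Stripping the constructors turns \<open>h\<close> into maps to numbers and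
      braids. The unspecified values of the case expressions never occur on cells, because
      \<open>h\<close> lands in the ranges of \<open>Two\<close> and \<open>Three\<close>.\<close>
    define u where "u = (\<lambda>x. case h 2 x of Two n \<Rightarrow> n)"
    define v where "v = (\<lambda>x. case h 3 x of Three b \<Rightarrow> b)"
    have "bij_betw (h k) (cells A k) (b_cells k)" if "k \<le> 3" for k
      using iso that by (simp add: magma_iso_def)
    from this[of 2] this[of 3]
    have bij: "bij_betw (h 2) (cells A 2) (range Two)" "bij_betw (h 3) (cells A 3) (range Three)"
      by simp_all
    have h: "h 2 x = Two (u x)" if "x \<in> cells A 2" for x
      using bij_betwE[OF bij(1)] that by (fastforce simp: u_def)
    have h3: "h 3 x = Three (v x)" if "x \<in> cells A 3" for x
      using bij_betwE[OF bij(2)] that by (fastforce simp: v_def)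
    have map: "magma_map ?P braid_gray h" "rg_map ?P braid_gray h"
      using iso by (auto simp: magma_iso_def magma_map_def)
    show False
    proof (rule penon_not_braid_category[OF adj rg dd])
      show "inj_on u (cells A 2)"
        using inj_onD[OF bij_betw_imp_inj_on[OF bij(1)]] h by (simp add: inj_on_def)
      have "bij_betw (\<lambda>b. case b of Three b \<Rightarrow> b) (range Three) UNIV"
        by (intro bij_betw_byWitness[of _ Three]) auto
      from bij_betw_trans[OF bij(2) this] show "bij_betw v (cells A 3) UNIV"
        by (simp add: v_def o_def)
      show "u (src A 3 f) = strands (v f) \<and> u (tgt A 3 f) = strands (v f)" if f: "f \<in> cells A 3" for f
      proof -
        have "(1::nat) \<le> 3 \<and> 3 \<le> (3::nat) \<and> f \<in> cells ?P 3 \<longrightarrow> h (3 - 1) (src ?P 3 f) = src braid_gray 3 (h 3 f) \<and>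
            h (3 - 1) (tgt ?P 3 f) = tgt braid_gray 3 (h 3 f)"
          using map(2) unfolding rg_map_def by blast
        then show ?thesis using f h h3[OF f] st[of 3 f] by simp
      qed
      show "v (comp ?P 3 1 f g) = braid_tensor (v f) (v g)"
        if fg: "f \<in> cells A 3" "g \<in> cells A 3" for f g
      proof -
        \<comment> \<open>A magma map preserves composites of composable cells only; uniqueness of
          the 1-cell makes every pair of 3-cells composable along it.\<close>
        have one: "src A 2 (src A 3 f) \<in> cells A 1" "tgt A 2 (tgt A 3 g) \<in> cells A 1"
          using st[of 3 f] st[of 3 g] st[of 2 "src A 3 f"] st[of 2 "tgt A 3 g"] fg by auto
        then have "composable ?P 3 1 f g"
          using fg dd by (auto simp: composable_def doubly_degenerate_def eval_nat_numeral)
        then have "h 3 (comp ?P 3 1 f g) = Three (braid_tensor (v f) (v g))"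
          using map(1) h3 fg by (simp add: magma_map_def)
        then show ?thesis by (simp add: v_def)
      qed
    qed
  qed
qed

end
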